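(* Let $\tau=\left\{\begin{pmatrix}A&B\\ C&D\end{pmatrix};\mathfrak H,\mathfrak M,\mathfrak N\right\}$ be a passive observable system and let $T=\begin{pmatrix}A&B\\ C&D\end{pmatrix}$. Define the sequence of nonnegative contractions in $\mathfrak H$: $$Y^{(0)}:=I_{\mathfrak H},\qquad Y^{(n+1)}:=\left(D_T^2+T^*Y^{(n)}P'_{\mathfrak H}T\right)_{\mathfrak H}\upharpoonright\mathfrak H,\quad n=0,1,\ldots.$$ Then: (1) the sequence $\{Y^{(n)}\}_{n=0}^\infty$ is nonincreasing; (2) the operator $Y_0:=s\text{-}\lim_{n\to\infty}Y^{(n)}$ satisfies the equality $$Y_0P_{\mathfrak H}=\left(D_T^2+T^*Y_0P'_{\mathfrak H}T\right)_{\mathfrak H}$$ and $\ker(I_{\mathfrak H}-Y_0)=\{0\}$; (3) the operator $Y_0$ is the maximal solution of the system $$YP_{\mathfrak H}\le\left(D_T^2+T^*YP'_{\mathfrak H}T\right)_{\mathfrak H},\qquad 0\le Y<I_{\mathfrak H}.$$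
   Context: Hilbert spaces are complex and separable. A passive system is given by a contraction $T=\begin{pmatrix}A&B\\C&D\end{pmatrix}:\mathfrak H\oplus\mathfrak M\to\mathfrak H\oplus\mathfrak N$; it is observable if $\bigcap_{n\ge0}\ker(CA^n)=\{0\}$. $D_T=(I-T^*T)^{1/2}$. $P_{\mathfrak H}$ (resp. $P'_{\mathfrak H}$) is the orthogonal projection onto $\mathfrak H$ in $\mathfrak H\oplus\mathfrak M$ (resp. $\mathfrak H\oplus\mathfrak N$). Shorted operator: for bounded $S\ge0$ in $\mathcal H$ and a closed subspace $\mathcal K$, $S_{\mathcal K}=\max\{Z:\ 0\le Z\le S,\ \mathrm{ran}\,Z\subseteq\mathcal K\}$; $\upharpoonright\mathfrak H$ is restriction to $\mathfrak H$. $Y$ is selfadjoint in $\mathfrak H$; $0\le Y<I_{\mathfrak H}$ means $0\le Y\le I_{\mathfrak H}$ and $\ker(I_{\mathfrak H}-Y)=\{0\}$. Maximal solution means a solution $Y_0$ with $Y\le Y_0$ for every solution $Y$. $s\text{-}\lim$ is the strong limit. *)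

theory Defs
  imports "HOL-Analysis.Analysis"
begin

section \<open>Complex separable Hilbert spaces\<close>

text \<open>The complex inner product is linear in the first argument. Its real part is the real inner
  product of the library, so norm, topology and completeness are those of the library.\<close>

class complex_inner = real_inner +
  fixes scaleC :: "complex \<Rightarrow> 'a \<Rightarrow> 'a" (infixr "*\<^sub>C" 75)
    and cinner :: "'a \<Rightarrow> 'a \<Rightarrow> complex"
  assumes scaleC_add_right: "c *\<^sub>C (x + y) = c *\<^sub>C x + c *\<^sub>C y"
    and scaleC_add_left: "(c + d) *\<^sub>C x = c *\<^sub>C x + d *\<^sub>C x"
    and scaleC_scaleC: "c *\<^sub>C (d *\<^sub>C x) = (c * d) *\<^sub>C x"
    and scaleC_of_real: "complex_of_real r *\<^sub>C x = r *\<^sub>R x"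
    and cinner_commute: "cinner x y = cnj (cinner y x)"
    and cinner_add_left: "cinner (x + y) z = cinner x z + cinner y z"
    and cinner_scaleC_left: "cinner (c *\<^sub>C x) y = c * cinner x y"
    and Re_cinner: "Re (cinner x y) = inner x y"

class complex_hilbert = complex_inner + complete_space +
  assumes separable: "\<exists>S. countable S \<and> (\<forall>x. \<forall>e>0. \<exists>y\<in>S. dist y x < e)"

text \<open>The Hilbert direct sum is the product type: the library norm on it is
  \<open>norm (x, y) = sqrt ((norm x)\<^sup>2 + (norm y)\<^sup>2)\<close>.\<close>

instantiation prod :: (complex_inner, complex_inner) complex_inner
begin

definition scaleC_prod_def: "c *\<^sub>C x = (c *\<^sub>C fst x, c *\<^sub>C snd x)"

definition cinner_prod_def: "cinner x y = cinner (fst x) (fst y) + cinner (snd x) (snd y)"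

instance
proof
  fix x y z :: "'a \<times> 'b" and c d :: complex and r :: real
  show "c *\<^sub>C (x + y) = c *\<^sub>C x + c *\<^sub>C y"
    by (simp add: scaleC_prod_def scaleC_add_right)
  show "(c + d) *\<^sub>C x = c *\<^sub>C x + d *\<^sub>C x"
    by (simp add: scaleC_prod_def scaleC_add_left)
  show "c *\<^sub>C (d *\<^sub>C x) = (c * d) *\<^sub>C x"
    by (simp add: scaleC_prod_def scaleC_scaleC)
  show "complex_of_real r *\<^sub>C x = r *\<^sub>R x"
    by (simp add: scaleC_prod_def scaleC_of_real prod_eq_iff)
  show "cinner x y = cnj (cinner y x)"
    unfolding cinner_prod_def complex_cnj_add
    by (simp only: cinner_commute [symmetric])
  show "cinner (x + y) z = cinner x z + cinner y z"
    by (simp add: cinner_prod_def cinner_add_left)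
  show "cinner (c *\<^sub>C x) y = c * cinner x y"
    by (simp add: cinner_prod_def scaleC_prod_def cinner_scaleC_left distrib_left)
  show "Re (cinner x y) = inner x y"
    by (simp add: cinner_prod_def Re_cinner inner_prod_def)
qed

end

lemma complex_hilbert_separable: "\<exists>S :: 'a::complex_hilbert set. countable S \<and> closure S = UNIV"
  using separable [where 'a = 'a] by (auto simp: set_eq_iff closure_approachable)

instance prod :: (complex_hilbert, complex_hilbert) complex_hilbert
proof
  obtain S :: "'a set" and R :: "'b set"
    where "countable S" "closure S = UNIV" "countable R" "closure R = UNIV"
    using complex_hilbert_separable by metis
  then have "countable (S \<times> R)" and "closure (S \<times> R) = UNIV"
    by (simp_all add: closure_Times)
  then show "\<exists>U :: ('a \<times> 'b) set. countable U \<and> (\<forall>x. \<forall>e>0. \<exists>y\<in>U. dist y x < e)"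
    by (metis UNIV_I closure_approachable)
qed

section \<open>Bounded operators\<close>

definition bounded_clinear :: "('a::complex_inner \<Rightarrow> 'b::complex_inner) \<Rightarrow> bool" where
  "bounded_clinear f \<longleftrightarrow> bounded_linear f \<and> (\<forall>c x. f (c *\<^sub>C x) = c *\<^sub>C f x)"

definition contraction :: "('a::complex_inner \<Rightarrow> 'b::complex_inner) \<Rightarrow> bool" where
  "contraction f \<longleftrightarrow> bounded_clinear f \<and> (\<forall>x. norm (f x) \<le> norm x)"

definition adj :: "('a::complex_hilbert \<Rightarrow> 'b::complex_hilbert) \<Rightarrow> 'b \<Rightarrow> 'a" where
  "adj f = (THE g. \<forall>x y. cinner (f x) y = cinner x (g y))"

definition selfadjoint :: "('a::complex_inner \<Rightarrow> 'a) \<Rightarrow> bool" where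
  "selfadjoint S \<longleftrightarrow> bounded_clinear S \<and> (\<forall>x y. cinner (S x) y = cinner x (S y))"

text \<open>The order on bounded selfadjoint operators; their quadratic forms \<open>cinner (S x) x\<close> are real.\<close>

definition op_le :: "('a::complex_inner \<Rightarrow> 'a) \<Rightarrow> ('a \<Rightarrow> 'a) \<Rightarrow> bool" where
  "op_le S R \<longleftrightarrow> selfadjoint S \<and> selfadjoint R \<and>
     (\<forall>x. Re (cinner (S x) x) \<le> Re (cinner (R x) x))"

definition nonneg_op :: "('a::complex_inner \<Rightarrow> 'a) \<Rightarrow> bool" where
  "nonneg_op S \<longleftrightarrow> op_le (\<lambda>_. 0) S"

text \<open>The nonnegative square root of \<open>S \<ge> 0\<close> is unique, so the choice is immaterial.\<close>

definition op_sqrt :: "('a::complex_hilbert \<Rightarrow> 'a) \<Rightarrow> 'a \<Rightarrow> 'a" where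
  "op_sqrt S = (SOME R. nonneg_op R \<and> R \<circ> R = S)"

definition defect :: "('a::complex_hilbert \<Rightarrow> 'b::complex_hilbert) \<Rightarrow> 'a \<Rightarrow> 'a" where
  "defect T = op_sqrt (\<lambda>x. x - adj T (T x))"

definition op_kernel :: "('a::complex_inner \<Rightarrow> 'b::complex_inner) \<Rightarrow> 'a set" where
  "op_kernel f = {x. f x = 0}"

definition strong_limit ::
    "(nat \<Rightarrow> 'a::complex_inner \<Rightarrow> 'b::complex_inner) \<Rightarrow> ('a \<Rightarrow> 'b) \<Rightarrow> bool" where
  "strong_limit X L \<longleftrightarrow> bounded_clinear L \<and> (\<forall>x. (\<lambda>n. X n x) \<longlonglongrightarrow> L x)"

text \<open>The shorted operator, the largest \<open>Z\<close> with \<open>0 \<le> Z \<le> S\<close> and range in the closed subspace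
  \<open>K\<close>; it is meaningful for \<open>S \<ge> 0\<close> only.\<close>

definition short_candidates :: "('a::complex_hilbert \<Rightarrow> 'a) \<Rightarrow> 'a set \<Rightarrow> ('a \<Rightarrow> 'a) set" where
  "short_candidates S K = {Z. nonneg_op Z \<and> op_le Z S \<and> range Z \<subseteq> K}"

definition shorted :: "('a::complex_hilbert \<Rightarrow> 'a) \<Rightarrow> 'a set \<Rightarrow> 'a \<Rightarrow> 'a" where
  "shorted S K = (THE Z. Z \<in> short_candidates S K \<and> (\<forall>Z' \<in> short_candidates S K. op_le Z' Z))"

section \<open>Passive systems\<close>

definition block_op ::
    "('h::complex_hilbert \<Rightarrow> 'h) \<Rightarrow> ('m::complex_hilbert \<Rightarrow> 'h) \<Rightarrow>
      ('h \<Rightarrow> 'n::complex_hilbert) \<Rightarrow> ('m \<Rightarrow> 'n) \<Rightarrow> 'h \<times> 'm \<Rightarrow> 'h \<times> 'n" where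
  "block_op A B C D = (\<lambda>(h, m). (A h + B m, C h + D m))"

definition passive_system ::
    "('h::complex_hilbert \<Rightarrow> 'h) \<Rightarrow> ('m::complex_hilbert \<Rightarrow> 'h) \<Rightarrow>
      ('h \<Rightarrow> 'n::complex_hilbert) \<Rightarrow> ('m \<Rightarrow> 'n) \<Rightarrow> bool" where
  "passive_system A B C D \<longleftrightarrow>
     bounded_clinear A \<and> bounded_clinear B \<and> bounded_clinear C \<and> bounded_clinear D \<and>
     contraction (block_op A B C D)"

definition observable ::
    "('h::complex_hilbert \<Rightarrow> 'h) \<Rightarrow> ('h \<Rightarrow> 'n::complex_hilbert) \<Rightarrow> bool" where
  "observable A C \<longleftrightarrow> (\<Inter>n. op_kernel (C \<circ> (A ^^ n))) = {0}"

text \<open>The first summand of a direct sum, as a closed subspace. Under the identification of \<open>h\<close> with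
  \<open>(h, 0)\<close>, the orthogonal projection onto it is \<^const>\<open>fst\<close>.\<close>

definition fst_summand :: "('h::complex_hilbert \<times> 'k::complex_hilbert) set" where
  "fst_summand = UNIV \<times> {0}"

text \<open>For \<open>Y\<close> acting in the first summand, \<open>comp_proj Y\<close> is \<open>Y P\<close> with \<open>P\<close> the orthogonal
  projection onto that summand. It serves for both \<open>P\<close> and \<open>P'\<close>, the second summand being
  polymorphic.\<close>

definition comp_proj ::
    "('h::complex_hilbert \<Rightarrow> 'h) \<Rightarrow> 'h \<times> 'k::complex_hilbert \<Rightarrow> 'h \<times> 'k" where
  "comp_proj Y x = (Y (fst x), 0)"

text \<open>\<open>short_op T Y\<close> is the shorted operator of \<open>D_T\<^sup>2 + T\<^sup>* Y P' T\<close> to the first summand.\<close>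

definition short_op ::
    "('h::complex_hilbert \<times> 'm::complex_hilbert \<Rightarrow> 'h \<times> 'n::complex_hilbert) \<Rightarrow>
      ('h \<Rightarrow> 'h) \<Rightarrow> 'h \<times> 'm \<Rightarrow> 'h \<times> 'm" where
  "short_op T Y = shorted
     (\<lambda>x. defect T (defect T x) + adj T (comp_proj Y (T x))) fst_summand"

text \<open>\<open>short_op T Y\<close> maps into the first summand, so \<^const>\<open>fst\<close> in the recursion only undoes the
  identification of \<open>h\<close> with \<open>(h, 0)\<close>.\<close>

primrec Yseq ::
    "('h::complex_hilbert \<times> 'm::complex_hilbert \<Rightarrow> 'h \<times> 'n::complex_hilbert) \<Rightarrow>
      nat \<Rightarrow> 'h \<Rightarrow> 'h" where
  "Yseq T 0 = (\<lambda>h. h)"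
| "Yseq T (Suc n) = (\<lambda>h. fst (short_op T (Yseq T n) (h, 0)))"

text \<open>Solutions of \<open>Y P \<le> (D_T\<^sup>2 + T\<^sup>* Y P' T)\<close> shorted to the first summand, with \<open>0 \<le> Y < I\<close>.\<close>

definition solution ::
    "('h::complex_hilbert \<times> 'm::complex_hilbert \<Rightarrow> 'h \<times> 'n::complex_hilbert) \<Rightarrow>
      ('h \<Rightarrow> 'h) \<Rightarrow> bool" where
  "solution T Y \<longleftrightarrow>
     nonneg_op Y \<and> op_le Y (\<lambda>h. h) \<and> op_kernel (\<lambda>h. h - Y h) = {0} \<and>
     op_le (comp_proj Y) (short_op T Y)"

end

(* Up to the identification of h with (h, 0), the form of Y^(n+1) at h is the infimum over m of
   |(h, m)|^2 - |T (h, m)|^2 + (Y^(n) P' T (h, m), P' T (h, m)), so the recursion is a monotone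
   Bellman iteration started at I: it decreases to its largest fixed point below I, and every
   solution of the inequality stays below all iterates. *)

theory Submission
  imports Defs
begin

section \<open>Complex inner products and their real parts\<close>

text \<open>\<open>adj\<close>, \<open>op_sqrt\<close> and \<open>shorted\<close> are given by
  description or choice, so nothing is known about them until an object with the required property
  is exhibited. This is why the Riesz theorem, a square root and a concrete shorted operator are
  constructed. Square roots and shorts are needed only between \<open>0\<close> and
  \<open>I\<close>: if \<open>0 <= Y <= I\<close>, then the operator to be shorted,
  \<open>I - T* (I - Y) P' T\<close> up to the embedding, also lies there. Shorting enters only
  through its maximality, which makes it monotone. In the limit only quadratic forms of unshorted
  operators are passed through, and the fixed-point equation is obtained as two inequalities.
  Observability is what excludes nonzero vectors fixed by the limit: such vectors form an
  \<open>A\<close>-invariant subspace of the kernel of \<open>C\<close>.\<close>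

lemma inner_scaleC_ii: "inner (\<i> *\<^sub>C x) y = - Im (cinner x y)"
  by (simp add: Re_cinner [symmetric] cinner_scaleC_left)

text \<open>The imaginary part of \<open>cinner\<close> is a real inner product after multiplication
  by \<open>\<i>\<close>. Complex identities thus reduce to real ones.\<close>

lemma cinner_eqI:
  assumes "inner x y = inner z w" and "inner (\<i> *\<^sub>C x) y = inner (\<i> *\<^sub>C z) w"
  shows "cinner x y = cinner z w"
  using assms by (simp add: complex_eq_iff Re_cinner inner_scaleC_ii)

lemma cinner_scaleC_right: "cinner x (c *\<^sub>C y) = cnj c * cinner x y"
  by (metis cinner_commute cinner_scaleC_left complex_cnj_mult)

lemma norm_scaleC: "norm (c *\<^sub>C x) = cmod c * norm x"
proof -
  have "cinner x x = complex_of_real (inner x x)"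
    using cinner_commute [of x x] by (simp add: complex_eq_iff Re_cinner)
  then have "cinner (c *\<^sub>C x) (c *\<^sub>C x) = complex_of_real ((cmod c)\<^sup>2 * inner x x)"
    using complex_norm_square [of c] by (simp add: cinner_scaleC_left cinner_scaleC_right)
  then have "(norm (c *\<^sub>C x))\<^sup>2 = (cmod c * norm x)\<^sup>2"
    by (simp add: power_mult_distrib power2_norm_eq_inner flip: Re_cinner)
  then show ?thesis
    by simp
qed

lemma scaleC_scaleR: "c *\<^sub>C (r *\<^sub>R x) = r *\<^sub>R (c *\<^sub>C x)"
  by (simp add: scaleC_scaleC mult.commute flip: scaleC_of_real)

lemma bounded_linear_scaleC: "bounded_linear ((*\<^sub>C) c)"
  by (rule bounded_linear_intro [where K = "cmod c"])
    (simp_all add: scaleC_add_right scaleC_scaleR norm_scaleC)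

lemma inner_scaleC_left: "inner (c *\<^sub>C x) y = inner x (cnj c *\<^sub>C y)"
  by (simp add: cinner_scaleC_left cinner_scaleC_right flip: Re_cinner)

section \<open>Bounded complex linear operators\<close>

lemma bounded_clinear_bounded_linear: "bounded_clinear f \<Longrightarrow> bounded_linear f"
  by (simp add: bounded_clinear_def)

lemma bounded_clinear_add: "bounded_clinear f \<Longrightarrow> f (x + y) = f x + f y"
  by (simp add: bounded_clinear_def linear_simps)

lemma bounded_clinear_diff: "bounded_clinear f \<Longrightarrow> f (x - y) = f x - f y"
  by (simp add: bounded_clinear_def linear_simps)

lemma bounded_clinear_scaleR: "bounded_clinear f \<Longrightarrow> f (r *\<^sub>R x) = r *\<^sub>R f x"
  by (simp add: bounded_clinear_def linear_simps)

lemma bounded_clinear_zero: "bounded_clinear f \<Longrightarrow> f 0 = 0"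
  by (simp add: bounded_clinear_def linear_simps)

lemma bounded_clinear_const_zero: "bounded_clinear (\<lambda>_. 0)"
  by (simp add: bounded_clinear_def bounded_linear_zero linear_simps [OF bounded_linear_scaleC])

lemma bounded_clinear_ident: "bounded_clinear (\<lambda>x. x)"
  by (simp add: bounded_clinear_def bounded_linear_ident)

lemma bounded_clinear_plus:
  "bounded_clinear f \<Longrightarrow> bounded_clinear g \<Longrightarrow> bounded_clinear (\<lambda>x. f x + g x)"
  by (simp add: bounded_clinear_def bounded_linear_add scaleC_add_right)

lemma bounded_clinear_minus:
  "bounded_clinear f \<Longrightarrow> bounded_clinear g \<Longrightarrow> bounded_clinear (\<lambda>x. f x - g x)"
  by (simp add: bounded_clinear_def bounded_linear_sub
      linear_diff [OF bounded_linear.linear [OF bounded_linear_scaleC]])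

lemma bounded_clinear_times:
  "bounded_clinear f \<Longrightarrow> bounded_clinear (\<lambda>x. r *\<^sub>R f x)"
  by (simp add: bounded_clinear_def bounded_linear_const_scaleR scaleC_scaleR)

lemma bounded_clinear_compose:
  "bounded_clinear f \<Longrightarrow> bounded_clinear g \<Longrightarrow> bounded_clinear (\<lambda>x. f (g x))"
  by (simp add: bounded_clinear_def bounded_linear_compose)

section \<open>Selfadjoint operators and their order\<close>

text \<open>Symmetry for the real inner product suffices because a complex linear operator commutes
  with \<open>\<i>\<close>. From here on the order is handled with \<open>inner\<close>
  alone.\<close>

lemma selfadjoint_iff:
  "selfadjoint S \<longleftrightarrow> bounded_clinear S \<and> (\<forall>x y. inner (S x) y = inner x (S y))"
proof -
  have "cinner (S x) y = cinner x (S y)"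
    if "bounded_clinear S" and "\<And>x y. inner (S x) y = inner x (S y)" for x y
    using that by (intro cinner_eqI) (simp_all add: bounded_clinear_def flip: that(2))
  moreover have "inner (S x) y = inner x (S y)"
    if "\<And>x y. cinner (S x) y = cinner x (S y)" for x y
    by (simp add: that flip: Re_cinner)
  ultimately show ?thesis
    unfolding selfadjoint_def by blast
qed

lemma selfadjoint_bounded_clinear: "selfadjoint S \<Longrightarrow> bounded_clinear S"
  by (simp add: selfadjoint_def)

lemma selfadjoint_inner: "selfadjoint S \<Longrightarrow> inner (S x) y = inner x (S y)"
  by (simp add: selfadjoint_iff)

lemma selfadjoint_ident: "selfadjoint (\<lambda>x. x)"
  by (simp add: selfadjoint_iff bounded_clinear_ident)

lemma selfadjoint_zero: "selfadjoint (\<lambda>_. 0)"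
  by (simp add: selfadjoint_iff bounded_clinear_const_zero)

lemma selfadjoint_plus:
  "selfadjoint S \<Longrightarrow> selfadjoint R \<Longrightarrow> selfadjoint (\<lambda>x. S x + R x)"
  by (simp add: selfadjoint_iff bounded_clinear_plus inner_add_left inner_add_right)

lemma selfadjoint_minus:
  "selfadjoint S \<Longrightarrow> selfadjoint R \<Longrightarrow> selfadjoint (\<lambda>x. S x - R x)"
  by (simp add: selfadjoint_iff bounded_clinear_minus inner_diff_left inner_diff_right)

lemma selfadjoint_times: "selfadjoint S \<Longrightarrow> selfadjoint (\<lambda>x. r *\<^sub>R S x)"
  by (simp add: selfadjoint_iff bounded_clinear_times)

lemma selfadjoint_conj: "selfadjoint S \<Longrightarrow> selfadjoint R \<Longrightarrow> selfadjoint (\<lambda>x. R (S (R x)))"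
  by (simp add: selfadjoint_iff bounded_clinear_compose [of S] bounded_clinear_compose [of R])

lemma op_le_iff:
  "op_le S R \<longleftrightarrow> selfadjoint S \<and> selfadjoint R \<and> (\<forall>x. inner (S x) x \<le> inner (R x) x)"
  by (simp add: op_le_def Re_cinner)

lemma op_leD: "op_le S R \<Longrightarrow> inner (S x) x \<le> inner (R x) x"
  by (simp add: op_le_iff)

lemma nonneg_op_iff: "nonneg_op S \<longleftrightarrow> selfadjoint S \<and> (\<forall>x. 0 \<le> inner (S x) x)"
  by (auto simp: nonneg_op_def op_le_iff selfadjoint_zero)

lemma nonneg_op_minus: "op_le S R \<Longrightarrow> nonneg_op (\<lambda>x. R x - S x)"
  by (simp add: nonneg_op_iff op_le_iff selfadjoint_minus inner_diff_left)

lemma nonneg_op_conj: "nonneg_op S \<Longrightarrow> selfadjoint R \<Longrightarrow> nonneg_op (\<lambda>x. R (S (R x)))"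
  by (simp add: nonneg_op_iff selfadjoint_conj selfadjoint_inner [of R])

lemma op_le_trans: "op_le P Q \<Longrightarrow> op_le Q R \<Longrightarrow> op_le P R"
  by (auto simp: op_le_iff intro: order_trans)

lemma form_zero_imp_zero:
  assumes "selfadjoint S" and "\<And>x. inner (S x) x = 0"
  shows "S x = 0"
proof -
  \<comment> \<open>Polarisation: the cross terms at \<open>x + S x\<close> are both the squared
    norm of \<open>S x\<close>, and the diagonal terms vanish.\<close>
  have "inner (S (x + S x)) (x + S x) = 2 * inner (S x) (S x)"
    using assms selfadjoint_inner [OF assms(1), of "S x" x]
    by (simp add: bounded_clinear_add selfadjoint_bounded_clinear inner_add_left inner_add_right
        inner_commute)
  then show ?thesis
    using assms(2) [of "x + S x"] by simp
qed

text \<open>This gives uniqueness of a greatest element, hence of the operator described by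
  \<open>shorted\<close>.\<close>

lemma op_le_antisym:
  assumes "op_le S R" and "op_le R S"
  shows "S = R"
proof
  fix x
  have "S x - R x = 0"
    using assms
    by (intro form_zero_imp_zero [where S = "\<lambda>x. S x - R x"])
      (auto simp: op_le_iff selfadjoint_minus inner_diff_left intro: antisym)
  then show "S x = R x"
    by simp
qed

lemma nonneg_op_Cauchy_Schwarz:
  assumes "nonneg_op S"
  shows "(inner (S x) y)\<^sup>2 \<le> inner (S x) x * inner (S y) y"
proof -
  define a b c where "a = inner (S x) x" "b = inner (S x) y" "c = inner (S y) y"
  have sa: "selfadjoint S" and pos: "\<And>x. 0 \<le> inner (S x) x"
    using assms by (auto simp: nonneg_op_iff)
  have bl: "bounded_clinear S"
    using sa by (rule selfadjoint_bounded_clinear)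
  have form: "0 \<le> a + 2 * t * b + t\<^sup>2 * c" for t
  proof -
    have "inner (S (x + t *\<^sub>R y)) (x + t *\<^sub>R y) = a + 2 * t * b + t\<^sup>2 * c"
      using selfadjoint_inner [OF sa, of y x]
      by (simp add: bounded_clinear_add [OF bl] bounded_clinear_scaleR [OF bl] a_b_c_def
          algebra_simps power2_eq_square inner_commute)
    then show ?thesis
      using pos by metis
  qed
  have "0 \<le> c"
    by (simp add: a_b_c_def pos)
  show ?thesis
  proof (cases "c = 0")
    case True
    have "b = 0"
    proof (rule ccontr)
      assume "b \<noteq> 0"
      \<comment> \<open>The form is now affine in \<open>t\<close>; this \<open>t\<close> gives it
        the value \<open>-1\<close>.\<close>
      then show False
        using form [of "- (a + 1) / (2 * b)"] True by (simp add: field_simps)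
    qed
    then show ?thesis
      using pos by (simp add: a_b_c_def)
  next
    case False
    with \<open>0 \<le> c\<close> have "0 < c"
      by simp
    \<comment> \<open>\<open>t = - b / c\<close> minimises the quadratic.\<close>
    then have "0 \<le> a - b\<^sup>2 / c"
      using form [of "- b / c"] by (simp add: field_simps power2_eq_square)
    then show ?thesis
      using \<open>0 < c\<close> by (simp add: a_b_c_def [symmetric] field_simps)
  qed
qed

lemma nonneg_op_form_zero:
  assumes "nonneg_op S" and "inner (S x) x = 0"
  shows "S x = 0"
  using nonneg_op_Cauchy_Schwarz [OF assms(1), of x "S x"] assms(2) by simp

text \<open>Cauchy-Schwarz for the form of \<open>S\<close> with \<open>y = S x\<close>, followed by
  \<open>S <= I\<close> in the last factor. It turns convergence of forms into convergence of
  vectors.\<close>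

lemma nonneg_op_norm_le_form:
  assumes "nonneg_op S" and "op_le S (\<lambda>x. x)"
  shows "(norm (S x))\<^sup>2 \<le> inner (S x) x"
proof (cases "S x = 0")
  case False
  have "((norm (S x))\<^sup>2)\<^sup>2 \<le> inner (S x) x * inner (S (S x)) (S x)"
    using nonneg_op_Cauchy_Schwarz [OF assms(1), of x "S x"] by (simp add: power2_norm_eq_inner)
  also have "\<dots> \<le> inner (S x) x * (norm (S x))\<^sup>2"
    using assms by (intro mult_left_mono) (auto simp: nonneg_op_iff op_le_iff power2_norm_eq_inner)
  finally have "(norm (S x))\<^sup>2 * (norm (S x))\<^sup>2 \<le> inner (S x) x * (norm (S x))\<^sup>2"
    by (simp add: power2_eq_square)
  then show ?thesis
    using False by (simp only: mult_le_cancel_right) simp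
qed simp

lemma nonneg_op_le_ident_norm:
  assumes "nonneg_op S" and "op_le S (\<lambda>x. x)"
  shows "norm (S x) \<le> norm x"
proof -
  have "inner (S x) x \<le> (norm x)\<^sup>2"
    using assms(2) by (simp add: op_le_iff power2_norm_eq_inner)
  then have "(norm (S x))\<^sup>2 \<le> (norm x)\<^sup>2"
    using nonneg_op_norm_le_form [OF assms, of x] by linarith
  then show ?thesis
    by (simp add: power2_le_iff_abs_le)
qed

section \<open>Projections, the Riesz theorem and adjoints\<close>

lemma projection_exists:
  fixes V :: "'a::{real_inner,complete_space} set"
  assumes "subspace V" and "closed V"
  shows "\<exists>p\<in>V. \<forall>v\<in>V. inner (x - p) v = 0"
proof -
  define d where "d = infdist x V"
  have V0: "V \<noteq> {}"
    using subspace_0 [OF assms(1)] by blast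
  have d0: "0 \<le> d"
    by (simp add: d_def infdist_nonneg)
  have d_le: "d\<^sup>2 \<le> (norm (x - v))\<^sup>2" if "v \<in> V" for v
    using infdist_le [OF that, of x] d0 by (simp add: d_def dist_norm power_mono)
  have "\<exists>p\<in>V. (norm (x - p))\<^sup>2 < d\<^sup>2 + inverse (real (Suc n))" for n
  proof -
    have "d < sqrt (d\<^sup>2 + inverse (real (Suc n)))"
      by (rule real_less_rsqrt) simp
    then obtain p where "p \<in> V" "dist x p < sqrt (d\<^sup>2 + inverse (real (Suc n)))"
      using V0 by (auto simp: d_def infdist_def cInf_less_iff)
    then have "(norm (x - p))\<^sup>2 < (sqrt (d\<^sup>2 + inverse (real (Suc n))))\<^sup>2"
      by (intro power_strict_mono) (simp_all add: dist_norm)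
    then show ?thesis
      using \<open>p \<in> V\<close> by (auto intro!: bexI [of _ p])
  qed
  then obtain p where pV: "\<And>n. p n \<in> V"
    and p: "\<And>n. (norm (x - p n))\<^sup>2 < d\<^sup>2 + inverse (real (Suc n))"
    by metis
  \<comment> \<open>Parallelogram law: the midpoint of \<open>p m\<close> and \<open>p n\<close>
    lies in \<open>V\<close>, so its distance from \<open>x\<close> is at least
    \<open>d\<close>.\<close>
  have gap: "(norm (p m - p n))\<^sup>2 \<le> 2 * inverse (real (Suc m)) + 2 * inverse (real (Suc n))" for m n
  proof -
    have "(1/2) *\<^sub>R (p m + p n) \<in> V"
      using assms(1) pV by (simp add: subspace_add subspace_scale)
    then have "4 * d\<^sup>2 \<le> 4 * (norm (x - (1/2) *\<^sub>R (p m + p n)))\<^sup>2"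
      using d_le by simp
    also have "\<dots> = 2 * (norm (x - p m))\<^sup>2 + 2 * (norm (x - p n))\<^sup>2 - (norm (p m - p n))\<^sup>2"
      by (simp add: power2_norm_eq_inner algebra_simps inner_commute)
    finally show ?thesis
      using p [of m] p [of n] by linarith
  qed
  have "Cauchy p"
  proof (rule metric_CauchyI)
    fix e :: real
    assume "0 < e"
    then obtain N where N: "inverse (real (Suc N)) < e\<^sup>2 / 4"
      using reals_Archimedean [of "e\<^sup>2 / 4"] by auto
    have "dist (p m) (p n) < e" if "m \<ge> N" "n \<ge> N" for m n
    proof -
      have "inverse (real (Suc m)) \<le> inverse (real (Suc N))"
        "inverse (real (Suc n)) \<le> inverse (real (Suc N))"
        using that by (auto intro!: le_imp_inverse_le)
      then have "(norm (p m - p n))\<^sup>2 < e\<^sup>2"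
        using gap [of m n] N by linarith
      then show ?thesis
        using \<open>0 < e\<close> by (simp add: dist_norm power2_less_imp_less)
    qed
    then show "\<exists>N. \<forall>m\<ge>N. \<forall>n\<ge>N. dist (p m) (p n) < e"
      by blast
  qed
  then obtain q where q: "p \<longlonglongrightarrow> q"
    using Cauchy_convergent convergent_def by blast
  have qV: "q \<in> V"
    using assms(2) pV q by (metis closed_sequentially)
  have "(norm (x - q))\<^sup>2 \<le> d\<^sup>2 + 0"
  proof (rule LIMSEQ_le)
    show "(\<lambda>n. (norm (x - p n))\<^sup>2) \<longlonglongrightarrow> (norm (x - q))\<^sup>2"
      by (intro tendsto_intros q)
    show "(\<lambda>n. d\<^sup>2 + inverse (real (Suc n))) \<longlonglongrightarrow> d\<^sup>2 + 0"
      by (intro tendsto_intros LIMSEQ_inverse_real_of_nat)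
    show "\<exists>N. \<forall>n\<ge>N. (norm (x - p n))\<^sup>2 \<le> d\<^sup>2 + inverse (real (Suc n))"
      using p less_imp_le by blast
  qed
  then have q_min: "(norm (x - q))\<^sup>2 \<le> d\<^sup>2"
    by simp
  have "inner (x - q) v = 0" if "v \<in> V" for v
  proof (rule ccontr)
    assume nz: "inner (x - q) v \<noteq> 0"
    \<comment> \<open>The best step from \<open>q\<close> in the direction \<open>v\<close>; unless
      \<open>v\<close> is orthogonal to \<open>x - q\<close>, it would beat the minimal
      distance.\<close>
    define t where "t = inner (x - q) v / inner v v"
    have v0: "inner v v \<noteq> 0"
      using nz by auto
    have "q + t *\<^sub>R v \<in> V"
      using assms(1) qV that by (simp add: subspace_add subspace_scale)
    then have "(norm (x - q))\<^sup>2 \<le> (norm (x - (q + t *\<^sub>R v)))\<^sup>2"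
      using d_le q_min order_trans by blast
    also have "\<dots> = (norm (x - q))\<^sup>2 - (inner (x - q) v)\<^sup>2 / inner v v"
    proof -
      have "(norm (x - (q + t *\<^sub>R v)))\<^sup>2 =
          (norm (x - q))\<^sup>2 - 2 * t * inner (x - q) v + t * (t * inner v v)"
        by (simp add: power2_norm_eq_inner algebra_simps inner_commute)
      also have "t * inner v v = inner (x - q) v"
        using v0 by (simp add: t_def)
      finally show ?thesis
        by (simp add: t_def power2_eq_square)
    qed
    finally have "(inner (x - q) v)\<^sup>2 / inner v v \<le> 0"
      by simp
    moreover have "0 < (inner (x - q) v)\<^sup>2 / inner v v"
      using nz v0 by (simp add: order_less_le)
    ultimately show False
      by simp
  qed
  with qV show ?thesis
    by blast
qed

text \<open>The component \<open>w\<close> of \<open>a\<close> orthogonal to the kernel of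
  \<open>f\<close> spans the orthogonal complement of that kernel, so a multiple of \<open>w\<close>
  represents \<open>f\<close>.\<close>

lemma Riesz_representation:
  fixes f :: "'a::{real_inner,complete_space} \<Rightarrow> real"
  assumes "bounded_linear f"
  shows "\<exists>z. \<forall>x. f x = inner x z"
proof (cases "\<forall>x. f x = 0")
  case True
  then show ?thesis
    by (auto intro!: exI [of _ 0])
next
  case False
  then obtain a where a: "f a \<noteq> 0"
    by blast
  interpret bounded_linear f
    by (fact assms)
  have sub: "subspace {x. f x = 0}"
    by (auto simp: subspace_def add scaleR zero)
  have "closed {x. f x = 0}"
    by (intro closed_Collect_eq continuous_on linear_continuous_on assms continuous_intros)
  with sub obtain p where p: "f p = 0" "\<And>v. f v = 0 \<Longrightarrow> inner (a - p) v = 0"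
    using projection_exists [of "{x. f x = 0}" a] by auto
  define w where "w = a - p"
  have fw: "f w = f a"
    by (simp add: w_def diff p)
  have w0: "inner w w \<noteq> 0"
    using fw a zero by auto
  have "f x = inner x ((f w / inner w w) *\<^sub>R w)" for x
  proof -
    have "f (x - (f x / f w) *\<^sub>R w) = 0"
      using a fw by (simp add: diff scaleR)
    then have "inner w (x - (f x / f w) *\<^sub>R w) = 0"
      unfolding w_def by (rule p(2))
    then have "inner w x = (f x / f w) * inner w w"
      by (simp add: inner_diff_right)
    then show ?thesis
      using w0 a fw by (simp add: inner_commute field_simps)
  qed
  then show ?thesis
    by blast
qed

lemma adjoint_exists:
  fixes f :: "'a::complex_hilbert \<Rightarrow> 'b::complex_hilbert"
  assumes "bounded_clinear f"
  shows "\<exists>g. \<forall>x y. cinner (f x) y = cinner x (g y)"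
proof -
  have "\<exists>z. \<forall>x. inner (f x) y = inner x z" for y
    using assms by (intro Riesz_representation)
      (simp add: bounded_clinear_bounded_linear bounded_linear_compose [OF bounded_linear_inner_left])
  then obtain g where g: "\<And>x y. inner (f x) y = inner x (g y)"
    by metis
  have "cinner (f x) y = cinner x (g y)" for x y
    using assms g [of "\<i> *\<^sub>C x" y] by (intro cinner_eqI g) (simp add: bounded_clinear_def)
  then show ?thesis
    by blast
qed

lemma cinner_adj:
  assumes "bounded_clinear f"
  shows "cinner (f x) y = cinner x (adj f y)"
proof -
  \<comment> \<open>\<open>adj\<close> is a definite description, so uniqueness is needed as well as
    existence.\<close>
  have "\<exists>!g. \<forall>x y. cinner (f x) y = cinner x (g y)"
  proof (rule ex_ex1I [OF adjoint_exists [OF assms]])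
    fix g h
    assume "\<forall>x y. cinner (f x) y = cinner x (g y)" "\<forall>x y. cinner (f x) y = cinner x (h y)"
    then have "inner x (g y) = inner x (h y)" for x y
      by (metis Re_cinner)
    then show "g = h"
      by (intro ext) (metis vector_eq_ldot)
  qed
  then have "\<forall>x y. cinner (f x) y = cinner x (adj f y)"
    unfolding adj_def by (rule theI')
  then show ?thesis
    by blast
qed

lemma inner_adj: "bounded_clinear f \<Longrightarrow> inner (f x) y = inner x (adj f y)"
  by (simp add: cinner_adj flip: Re_cinner)

lemma bounded_clinear_adj:
  assumes "bounded_clinear f"
  shows "bounded_clinear (adj f)"
proof -
  note g = inner_adj [OF assms, symmetric]
  obtain K where K: "K \<ge> 0" "\<And>x. norm (f x) \<le> norm x * K"
    using bounded_linear.nonneg_bounded [OF bounded_clinear_bounded_linear [OF assms]] by blast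
  have "norm (adj f y) \<le> norm y * K" for y
  proof -
    \<comment> \<open>The bound of \<open>f\<close> carries over to the adjoint after cancelling one
      factor \<open>norm (adj f y)\<close>.\<close>
    have "norm (adj f y) * norm (adj f y) = inner (f (adj f y)) y"
      by (simp add: inner_adj [OF assms] flip: power2_norm_eq_inner power2_eq_square)
    also have "\<dots> \<le> norm (f (adj f y)) * norm y"
      by (rule norm_cauchy_schwarz)
    also have "\<dots> \<le> norm (adj f y) * K * norm y"
      by (intro mult_right_mono K) simp
    finally show ?thesis
      using K(1) by (cases "adj f y = 0") (simp_all add: mult.assoc mult.commute)
  qed
  moreover have "adj f (y + z) = adj f y + adj f z" for y z
    using g by (intro vector_eq_ldot [THEN iffD1]) (simp add: inner_add_right)
  moreover have "adj f (r *\<^sub>R y) = r *\<^sub>R adj f y" for r y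
    using g by (intro vector_eq_ldot [THEN iffD1]) simp
  moreover have "adj f (c *\<^sub>C y) = c *\<^sub>C adj f y" for c y
  proof (rule vector_eq_ldot [THEN iffD1], rule allI)
    fix x
    have "inner x (adj f (c *\<^sub>C y)) = inner (f x) (c *\<^sub>C y)"
      by (rule g)
    also have "\<dots> = inner (f (cnj c *\<^sub>C x)) y"
      using assms inner_scaleC_left [of "cnj c" "f x" y] by (simp add: bounded_clinear_def)
    also have "\<dots> = inner (cnj c *\<^sub>C x) (adj f y)"
      by (rule inner_adj [OF assms])
    also have "\<dots> = inner x (c *\<^sub>C adj f y)"
      by (simp add: inner_scaleC_left)
    finally show "inner x (adj f (c *\<^sub>C y)) = inner x (c *\<^sub>C adj f y)" .
  qed
  ultimately show ?thesis
    unfolding bounded_clinear_def by (blast intro: bounded_linear_intro)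
qed

section \<open>Monotone limits and square roots\<close>

text \<open>The forms decrease and are bounded below, hence converge. Applied to the differences of
  the \<open>X n\<close>, the estimate of squared norm by form makes \<open>X n x\<close> a Cauchy
  sequence.\<close>

lemma op_decreasing_limit:
  fixes X :: "nat \<Rightarrow> 'a::complex_hilbert \<Rightarrow> 'a"
  assumes nonneg: "\<And>n. nonneg_op (X n)"
    and le_ident: "\<And>n. op_le (X n) (\<lambda>x. x)"
    and decr: "\<And>m n. m \<le> n \<Longrightarrow> op_le (X n) (X m)"
  shows "\<exists>L. strong_limit X L \<and> nonneg_op L \<and> (\<forall>n. op_le L (X n))"
proof -
  note bl = selfadjoint_bounded_clinear
  have sa: "selfadjoint (X n)" for n
    using nonneg by (simp add: nonneg_op_iff)
  have "convergent (\<lambda>n. X n x)" for x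
  proof -
    have "decseq (\<lambda>n. inner (X n x) x)"
      using decr by (auto simp: decseq_def op_le_iff)
    then have "convergent (\<lambda>n. inner (X n x) x)"
      unfolding convergent_def
    proof (rule decseq_convergent)
      show "\<forall>n. 0 \<le> inner (X n x) x"
        using nonneg by (simp add: nonneg_op_iff)
    qed blast
    then have C: "Cauchy (\<lambda>n. inner (X n x) x)"
      by (rule convergent_Cauchy)
    have gap: "(norm (X m x - X n x))\<^sup>2 \<le> inner (X m x) x - inner (X n x) x" if "m \<le> n" for m n
    proof -
      \<comment> \<open>The norm estimate needs an operator below \<open>I\<close>; subtracting the
        nonnegative \<open>X n\<close> from \<open>X m <= I\<close> keeps it there.\<close>
      have "op_le (\<lambda>x. X m x - X n x) (\<lambda>x. x)"
        unfolding op_le_iff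
      proof (intro conjI allI)
        show "inner (X m y - X n y) y \<le> inner y y" for y
        proof -
          have "inner (X m y) y \<le> inner y y" "0 \<le> inner (X n y) y"
            using le_ident [of m] nonneg [of n] by (auto simp: op_le_iff nonneg_op_iff)
          then show ?thesis
            by (simp add: inner_diff_left)
        qed
      qed (simp_all add: selfadjoint_minus selfadjoint_ident sa)
      from nonneg_op_norm_le_form [OF nonneg_op_minus [OF decr [OF that]] this]
      show ?thesis
        by (simp add: inner_diff_left)
    qed
    have "Cauchy (\<lambda>n. X n x)"
    proof (rule metric_CauchyI)
      fix e :: real
      assume "0 < e"
      then obtain N where N: "\<And>m n. m \<ge> N \<Longrightarrow> n \<ge> N \<Longrightarrow> dist (inner (X m x) x) (inner (X n x) x) < e\<^sup>2"
        using metric_CauchyD [OF C, of "e\<^sup>2"] by auto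
      have *: "dist (X m x) (X n x) < e" if "m \<ge> N" "n \<ge> N" "m \<le> n" for m n
      proof -
        have "(norm (X m x - X n x))\<^sup>2 < e\<^sup>2"
          using gap [OF that(3)] N [OF that(1,2)] by (simp add: dist_real_def abs_if split: if_splits)
        then show ?thesis
          using \<open>0 < e\<close> by (simp add: dist_norm power2_less_imp_less)
      qed
      have "dist (X m x) (X n x) < e" if "m \<ge> N" "n \<ge> N" for m n
        using * [OF that] * [OF that(2,1)] by (metis dist_commute nle_le)
      then show "\<exists>N. \<forall>m\<ge>N. \<forall>n\<ge>N. dist (X m x) (X n x) < e"
        by blast
    qed
    then show ?thesis
      by (rule Cauchy_convergent)
  qed
  then obtain L where L: "\<And>x. (\<lambda>n. X n x) \<longlonglongrightarrow> L x"
    unfolding convergent_def by metis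
  have add: "L (x + y) = L x + L y" for x y
  proof (rule LIMSEQ_unique [OF L])
    show "(\<lambda>n. X n (x + y)) \<longlonglongrightarrow> L x + L y"
      unfolding bounded_clinear_add [OF bl [OF sa]] by (intro tendsto_intros L)
  qed
  have scC: "L (c *\<^sub>C x) = c *\<^sub>C L x" for c x
  proof (rule LIMSEQ_unique [OF L])
    show "(\<lambda>n. X n (c *\<^sub>C x)) \<longlonglongrightarrow> c *\<^sub>C L x"
      using bounded_linear.tendsto [OF bounded_linear_scaleC L, of c x] bl [OF sa]
      by (simp add: bounded_clinear_def)
  qed
  have scR: "L (r *\<^sub>R x) = r *\<^sub>R L x" for r x
    using scC [of "complex_of_real r" x] by (simp add: scaleC_of_real)
  have "norm (L x) \<le> norm x * 1" for x
    using nonneg_op_le_ident_norm [OF nonneg le_ident]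
    by (intro LIMSEQ_le_const2 [OF tendsto_norm [OF L]]) auto
  then have blL: "bounded_clinear L"
    using add scR scC unfolding bounded_clinear_def by (blast intro: bounded_linear_intro)
  have form: "(\<lambda>n. inner (X n x) y) \<longlonglongrightarrow> inner (L x) y" for x y
    by (intro tendsto_intros L)
  have "inner (L x) y = inner x (L y)" for x y
  proof (rule LIMSEQ_unique [OF form])
    show "(\<lambda>n. inner (X n x) y) \<longlonglongrightarrow> inner x (L y)"
      unfolding selfadjoint_inner [OF sa] by (intro tendsto_intros L)
  qed
  then have saL: "selfadjoint L"
    by (simp add: selfadjoint_iff blL)
  moreover have "0 \<le> inner (L x) x" for x
    using nonneg by (intro LIMSEQ_le_const [OF form]) (auto simp: nonneg_op_iff)
  moreover have "inner (L x) x \<le> inner (X n x) x" for n x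
    using decr by (intro LIMSEQ_le_const2 [OF form]) (auto simp: op_le_iff)
  ultimately show ?thesis
    using L blL sa by (auto simp: strong_limit_def nonneg_op_iff op_le_iff)
qed

section \<open>Nonnegative square roots by a monotone iteration\<close>

lemma funpow_nonneg_op:
  assumes "nonneg_op A"
  shows "nonneg_op (A ^^ k)"
proof (induction k rule: induct_nat_012)
  case 0
  show ?case
    by (simp add: nonneg_op_iff selfadjoint_ident id_def)
next
  case 1
  show ?case
    using assms by simp
next
  case (ge2 k)
  \<comment> \<open>Two powers at a time: the congruence of \<open>A ^^ k\<close> by
    \<open>A\<close> preserves nonnegativity, which explains the two-step induction.\<close>
  have "A ^^ Suc (Suc k) = (\<lambda>x. A ((A ^^ k) (A x)))"
    by (simp add: fun_eq_iff funpow_swap1)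
  then show ?case
    using nonneg_op_conj [OF ge2(1), of A] assms by (simp add: nonneg_op_iff)
qed

text \<open>Polynomials in \<open>A\<close> with nonnegative coefficients. Positivity of the iterates below has to be
  read off this form, since a product of noncommuting nonnegative operators need not be
  nonnegative.\<close>

inductive_set poly_cone :: "('a::complex_inner \<Rightarrow> 'a) \<Rightarrow> ('a \<Rightarrow> 'a) set" for A where
  zero: "(\<lambda>_. 0) \<in> poly_cone A"
| step: "f \<in> poly_cone A \<Longrightarrow> 0 \<le> r \<Longrightarrow> (\<lambda>x. f x + r *\<^sub>R (A ^^ k) x) \<in> poly_cone A"

lemma poly_cone_nonneg_op:
  assumes "nonneg_op A" and "f \<in> poly_cone A"
  shows "nonneg_op f"
  using assms(2)
proof induction
  case zero
  show ?case
    by (simp add: nonneg_op_iff selfadjoint_zero)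
next
  case (step f r k)
  then show ?case
    using funpow_nonneg_op [OF assms(1), of k]
    by (simp add: nonneg_op_iff selfadjoint_plus selfadjoint_times inner_add_left)
qed

lemma poly_cone_plus:
  assumes "f \<in> poly_cone A" and "g \<in> poly_cone A"
  shows "(\<lambda>x. f x + g x) \<in> poly_cone A"
  using assms(2)
proof induction
  case zero
  show ?case
    using assms(1) by simp
next
  case (step g r k)
  then show ?case
    using poly_cone.step [OF step.IH step.hyps(2)] by (simp add: add.assoc)
qed

lemma poly_cone_times:
  assumes "f \<in> poly_cone A" and "0 \<le> s"
  shows "(\<lambda>x. s *\<^sub>R f x) \<in> poly_cone A"
  using assms(1)
proof induction
  case zero
  show ?case
    by (simp add: poly_cone.zero)
next
  case (step f r k)
  then show ?case
    using poly_cone.step [OF step.IH, of "s * r"] assms(2) by (simp add: scaleR_add_right)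
qed

lemma poly_cone_base: "A \<in> poly_cone A"
  using poly_cone.step [OF poly_cone.zero, where r = 1 and k = 1 and A = A] by simp

text \<open>Powers of one operator multiply by adding exponents, so products of nonnegative
  coefficients stay nonnegative.\<close>

lemma poly_cone_compose:
  assumes "bounded_clinear A" and "f \<in> poly_cone A" and "g \<in> poly_cone A"
  shows "(\<lambda>x. f (g x)) \<in> poly_cone A"
proof -
  have bl: "bounded_clinear (A ^^ k)" for k
    using assms(1) by (induction k) (simp_all add: bounded_clinear_ident bounded_clinear_compose id_def comp_def)
  have power: "(\<lambda>x. (A ^^ k) (g x)) \<in> poly_cone A" for k
    using assms(3)
  proof induction
    case zero
    show ?case
      by (simp add: poly_cone.zero bounded_clinear_zero [OF bl])
  next
    case (step g r j)
    then show ?case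
      using poly_cone.step [OF step.IH, of r "k + j"]
      by (simp add: bounded_clinear_add [OF bl] bounded_clinear_scaleR [OF bl] funpow_add)
  qed
  show ?thesis
    using assms(2)
  proof induction
    case zero
    show ?case
      by (rule poly_cone.zero)
  next
    case (step f r k)
    then show ?case
      by (intro poly_cone_plus poly_cone_times power)
  qed
qed

text \<open>The iterates increase to \<open>I - sqrt (I - A)\<close>, since \<open>R\<^sup>2 = I - A\<close> says that \<open>B = I - R\<close>
  satisfies \<open>2 B = A + B\<^sup>2\<close>.\<close>

primrec sqrt_iter :: "('a::complex_inner \<Rightarrow> 'a) \<Rightarrow> nat \<Rightarrow> 'a \<Rightarrow> 'a" where
  "sqrt_iter A 0 = (\<lambda>_. 0)"
| "sqrt_iter A (Suc n) = (\<lambda>x. (1/2) *\<^sub>R (A x + sqrt_iter A n (sqrt_iter A n x)))"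

lemma sqrt_iter_poly_cone:
  assumes "bounded_clinear A"
  shows "sqrt_iter A n \<in> poly_cone A"
proof (induction n)
  case 0
  show ?case
    by (simp add: poly_cone.zero)
next
  case (Suc n)
  show ?case
    using poly_cone_times [OF poly_cone_plus [OF poly_cone_base poly_cone_compose [OF assms Suc Suc]],
        of "1/2"] by simp
qed

text \<open>If \<open>b\<close> increases by \<open>d\<close>, then \<open>b\<^sup>2\<close>
  increases by \<open>b d + d b + d\<^sup>2\<close>. With \<open>b\<close> and \<open>d\<close> in
  the cone this is again in the cone, so the increments stay nonnegative.\<close>

lemma sqrt_iter_increment:
  assumes "nonneg_op A"
  shows "\<exists>d\<in>poly_cone A. \<forall>x. sqrt_iter A (Suc n) x = sqrt_iter A n x + d x"
proof (induction n)
  case 0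
  show ?case
    by (rule bexI [of _ "\<lambda>x. (1/2) *\<^sub>R A x"]) (simp_all add: poly_cone_times poly_cone_base)
next
  case (Suc n)
  then obtain d where d: "d \<in> poly_cone A" "\<And>x. sqrt_iter A (Suc n) x = sqrt_iter A n x + d x"
    by blast
  define b where "b = sqrt_iter A n"
  have bl: "bounded_clinear A"
    using assms by (simp add: nonneg_op_iff selfadjoint_bounded_clinear)
  have b: "b \<in> poly_cone A"
    unfolding b_def by (rule sqrt_iter_poly_cone [OF bl])
  have blc: "bounded_clinear f" if "f \<in> poly_cone A" for f
    using poly_cone_nonneg_op [OF assms that] by (simp add: nonneg_op_iff selfadjoint_bounded_clinear)
  have step: "sqrt_iter A (Suc (Suc n)) x =
      sqrt_iter A (Suc n) x + (1/2) *\<^sub>R (b (d x) + (d (b x) + d (d x)))" for x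
  proof -
    have "sqrt_iter A (Suc (Suc n)) x = (1/2) *\<^sub>R (A x + (b (b x + d x) + d (b x + d x)))"
      by (simp only: sqrt_iter.simps(2) [of A "Suc n"] d(2) b_def)
    also have "\<dots> = (1/2) *\<^sub>R (A x + b (b x)) + (1/2) *\<^sub>R (b (d x) + (d (b x) + d (d x)))"
      by (simp add: bounded_clinear_add [OF blc [OF b]] bounded_clinear_add [OF blc [OF d(1)]]
          flip: scaleR_add_right)
    finally show ?thesis
      by (simp add: b_def)
  qed
  have cone: "(\<lambda>x. (1/2) *\<^sub>R (b (d x) + (d (b x) + d (d x)))) \<in> poly_cone A"
    by (rule poly_cone_times [OF poly_cone_plus [OF poly_cone_compose [OF bl b d(1)]
          poly_cone_plus [OF poly_cone_compose [OF bl d(1) b] poly_cone_compose [OF bl d(1) d(1)]]]])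
      simp
  show ?case
    using step by (intro bexI [OF _ cone] allI)
qed

lemma op_sqrt_exists:
  fixes S :: "'a::complex_hilbert \<Rightarrow> 'a"
  assumes "nonneg_op S" and "op_le S (\<lambda>x. x)"
  shows "\<exists>R. nonneg_op R \<and> R \<circ> R = S"
proof -
  define A where "A x = x - S x" for x
  have sa: "selfadjoint S"
    using assms by (simp add: nonneg_op_iff)
  have A: "nonneg_op A"
    using nonneg_op_minus [OF assms(2)] by (simp add: A_def [abs_def])
  have blA: "bounded_clinear A"
    using A by (simp add: nonneg_op_iff selfadjoint_bounded_clinear)
  have A_le: "op_le A (\<lambda>x. x)"
    using assms A by (simp add: op_le_iff nonneg_op_iff A_def inner_diff_left)
  define B where "B = sqrt_iter A"
  have nonneg: "nonneg_op (B n)" for n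
    unfolding B_def by (rule poly_cone_nonneg_op [OF A sqrt_iter_poly_cone [OF blA]])
  have blB: "bounded_clinear (B n)" for n
    using nonneg by (simp add: nonneg_op_iff selfadjoint_bounded_clinear)
  \<comment> \<open>The iterates are contractions: each is half the sum of \<open>A\<close> and the
    square of the previous one.\<close>
  have B_norm: "norm (B n x) \<le> norm x" for n x
  proof (induction n arbitrary: x)
    case 0
    show ?case
      by (simp add: B_def)
  next
    case (Suc n)
    have "norm (A x) \<le> norm x"
      by (rule nonneg_op_le_ident_norm [OF A A_le])
    moreover have "norm (B n (B n x)) \<le> norm x"
      using Suc order_trans by blast
    ultimately have "norm (A x + B n (B n x)) \<le> 2 * norm x"
      using norm_triangle_ineq [of "A x" "B n (B n x)"] by linarith
    then show ?case
      by (simp add: B_def)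
  qed
  have B_le: "op_le (B n) (\<lambda>x. x)" for n
    unfolding op_le_iff
  proof (intro conjI allI)
    show "inner (B n x) x \<le> inner x x" for x
    proof -
      have "inner (B n x) x \<le> norm (B n x) * norm x"
        by (rule norm_cauchy_schwarz)
      also have "\<dots> \<le> norm x * norm x"
        by (intro mult_right_mono B_norm) simp
      finally show ?thesis
        by (simp add: power2_norm_eq_inner [symmetric] power2_eq_square)
    qed
  qed (use nonneg in \<open>simp_all add: nonneg_op_iff selfadjoint_ident\<close>)
  have B_step: "op_le (B n) (B (Suc n))" for n
  proof -
    obtain d where "d \<in> poly_cone A" "\<And>x. B (Suc n) x = B n x + d x"
      using sqrt_iter_increment [OF A, of n] unfolding B_def by blast
    then show ?thesis
      using nonneg [of n] nonneg [of "Suc n"] poly_cone_nonneg_op [OF A, of d]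
      by (simp add: op_le_iff nonneg_op_iff inner_add_left)
  qed
  have B_mono: "op_le (B m) (B n)" if "m \<le> n" for m n
    using that
  proof (induction rule: dec_induct)
    case base
    show ?case
      using nonneg by (simp add: op_le_iff nonneg_op_iff)
  next
    case (step n)
    then show ?case
      using B_step op_le_trans by blast
  qed
  \<comment> \<open>The increasing \<open>B n\<close> become a decreasing sequence between
    \<open>0\<close> and \<open>I\<close>, whose limit is the desired root.\<close>
  define X where "X n x = x - B n x" for n x
  have saX: "selfadjoint (X n)" for n
    using nonneg by (simp add: X_def [abs_def] selfadjoint_minus selfadjoint_ident nonneg_op_iff)
  have "nonneg_op (X n)" for n
    using nonneg_op_minus [OF B_le] by (simp add: X_def [abs_def])
  moreover have "op_le (X n) (\<lambda>x. x)" for n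
    using saX nonneg by (simp add: op_le_iff nonneg_op_iff selfadjoint_ident X_def inner_diff_left)
  moreover have "op_le (X n) (X m)" if "m \<le> n" for m n
    using saX B_mono [OF that] by (simp add: op_le_iff X_def inner_diff_left)
  ultimately obtain L where L: "strong_limit X L" "nonneg_op L"
    using op_decreasing_limit by metis
  define M where "M x = x - L x" for x
  have BM: "(\<lambda>n. B n x) \<longlonglongrightarrow> M x" for x
  proof -
    have "(\<lambda>n. x - X n x) \<longlonglongrightarrow> x - L x"
      using L(1) by (intro tendsto_intros) (simp add: strong_limit_def)
    then show ?thesis
      by (simp add: X_def M_def)
  qed
  \<comment> \<open>Strong convergence passes to the product because the \<open>B n\<close> are
    uniformly contractive.\<close>
  have "(\<lambda>n. B n (B n x - M x)) \<longlonglongrightarrow> 0" for x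
  proof (rule Lim_null_comparison)
    show "\<forall>\<^sub>F n in sequentially. norm (B n (B n x - M x)) \<le> norm (B n x - M x)"
      by (simp add: B_norm)
    show "(\<lambda>n. norm (B n x - M x)) \<longlonglongrightarrow> 0"
      using BM [of x] by (simp add: LIM_zero tendsto_norm_zero)
  qed
  then have BB: "(\<lambda>n. B n (B n x)) \<longlonglongrightarrow> M (M x)" for x
    using tendsto_add [OF _ BM [of "M x"], of "\<lambda>n. B n (B n x - M x)" 0]
    by (simp add: bounded_clinear_diff [OF blB])
  have M: "M x = (1/2) *\<^sub>R (A x + M (M x))" for x
  proof (rule LIMSEQ_unique)
    show "(\<lambda>n. B (Suc n) x) \<longlonglongrightarrow> M x"
      using BM by (rule LIMSEQ_Suc)
    show "(\<lambda>n. B (Suc n) x) \<longlonglongrightarrow> (1/2) *\<^sub>R (A x + M (M x))"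
      unfolding B_def sqrt_iter.simps by (intro tendsto_intros BB [unfolded B_def])
  qed
  have "L (L x) = S x" for x
  proof -
    have blL: "bounded_clinear L"
      using L(1) by (simp add: strong_limit_def)
    have "2 *\<^sub>R M x = A x + M (M x)"
      by (subst M) simp
    then show ?thesis
      by (simp add: M_def A_def bounded_clinear_diff [OF blL] algebra_simps scaleR_2)
  qed
  then show ?thesis
    using L(2) by (auto simp: fun_eq_iff)
qed

section \<open>Existence of the shorted operator\<close>

lemma subspace_closure:
  fixes V :: "'a::real_normed_vector set"
  assumes "subspace V"
  shows "subspace (closure V)"
  unfolding subspace_def
proof (intro conjI ballI allI)
  show "0 \<in> closure V"
    using subspace_0 [OF assms] closure_subset by blast
next
  fix x y
  assume "x \<in> closure V" "y \<in> closure V"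
  then obtain f g where "\<And>n. f n \<in> V" "f \<longlonglongrightarrow> x" "\<And>n. g n \<in> V" "g \<longlonglongrightarrow> y"
    unfolding closure_sequential by metis
  then show "x + y \<in> closure V"
    unfolding closure_sequential
    by (intro exI [of _ "\<lambda>n. f n + g n"]) (simp add: subspace_add [OF assms] tendsto_add)
next
  fix c x
  assume "x \<in> closure V"
  then obtain f where "\<And>n. f n \<in> V" "f \<longlonglongrightarrow> x"
    unfolding closure_sequential by metis
  then show "c *\<^sub>R x \<in> closure V"
    unfolding closure_sequential
    by (intro exI [of _ "\<lambda>n. c *\<^sub>R f n"]) (simp add: subspace_scale [OF assms] tendsto_scaleR)
qed

lemma orthogonal_projection:
  fixes V :: "'a::complex_hilbert set"
  assumes "subspace V" and "closed V" and "\<And>c v. v \<in> V \<Longrightarrow> c *\<^sub>C v \<in> V"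
  shows "\<exists>P. selfadjoint P \<and> range P \<subseteq> V \<and> (\<forall>x. \<forall>v\<in>V. inner (x - P x) v = 0)"
proof -
  obtain P where PV: "\<And>x. P x \<in> V" and P: "\<And>x v. v \<in> V \<Longrightarrow> inner (x - P x) v = 0"
    using projection_exists [OF assms(1,2)] by metis
  \<comment> \<open>Linearity of \<open>P\<close> is read off from this: the expected value
    satisfies the defining orthogonality.\<close>
  have unique: "P x = p" if "p \<in> V" "\<And>v. v \<in> V \<Longrightarrow> inner (x - p) v = 0" for x p
  proof -
    have "P x - p \<in> V"
      using assms(1) PV that(1) by (rule subspace_diff)
    then have "inner (P x - p) (P x - p) = 0"
      using P [of "P x - p" x] that(2) [of "P x - p"] by (simp add: inner_diff_left)
    then show ?thesis
      by simp
  qed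
  have split: "inner x v = inner (P x) v" if "v \<in> V" for x v
    using P [OF that, of x] by (simp add: inner_diff_left)
  have sym: "inner (P x) y = inner x (P y)" for x y
    using split [OF PV, of y x] split [OF PV, of x y] by (simp add: inner_commute)
  have add: "P (x + y) = P x + P y" for x y
    using assms(1) by (intro unique) (simp_all add: subspace_add PV P add_diff_add inner_add_left)
  have scR: "P (r *\<^sub>R x) = r *\<^sub>R P x" for r x
    using assms(1) by (intro unique) (simp_all add: subspace_scale PV P flip: scaleR_diff_right)
  have scC: "P (c *\<^sub>C x) = c *\<^sub>C P x" for c x
  proof (rule unique)
    show "inner (c *\<^sub>C x - c *\<^sub>C P x) v = 0" if "v \<in> V" for v
      using P [OF assms(3) [OF that], of x "cnj c"] by (simp add: inner_diff_left inner_scaleC_left)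
  qed (simp add: assms(3) PV)
  have "norm (P x) \<le> norm x * 1" for x
  proof -
    have "norm (P x) * norm (P x) = inner x (P x)"
      by (simp add: split [OF PV, of x x] flip: power2_norm_eq_inner power2_eq_square)
    also have "\<dots> \<le> norm x * norm (P x)"
      by (rule norm_cauchy_schwarz)
    finally show ?thesis
      by (cases "P x = 0") simp_all
  qed
  then have "bounded_clinear P"
    using add scR scC unfolding bounded_clinear_def by (blast intro: bounded_linear_intro)
  then show ?thesis
    using sym P PV by (auto simp: selfadjoint_iff)
qed

text \<open>With \<open>R = sqrt S\<close> and \<open>Q\<close> the projection onto the closure of \<open>R K\<^sup>\<bottom>\<close>, the shorted operator is
  \<open>R (I - Q) R\<close>: its form at \<open>x\<close> is the squared distance from \<open>R x\<close> to \<open>R K\<^sup>\<bottom>\<close>, that is the infimum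
  of the form of \<open>S\<close> over \<open>x + K\<^sup>\<bottom>\<close>.\<close>

lemma shorted_greatest:
  fixes S :: "'a::complex_hilbert \<Rightarrow> 'a"
  assumes "nonneg_op S" and "op_le S (\<lambda>x. x)"
    and K: "subspace K" "closed K" "\<And>c v. v \<in> K \<Longrightarrow> c *\<^sub>C v \<in> K"
  shows "shorted S K \<in> short_candidates S K \<and>
    (\<forall>Z \<in> short_candidates S K. op_le Z (shorted S K))"
proof -
  obtain R where R: "nonneg_op R" "R \<circ> R = S"
    using op_sqrt_exists [OF assms(1,2)] by blast
  have saR: "selfadjoint R"
    using R by (simp add: nonneg_op_iff)
  note blR = selfadjoint_bounded_clinear [OF saR]
  have RR: "R (R x) = S x" for x
    using R by (auto simp: fun_eq_iff)
  \<comment> \<open>\<open>K\<close> is closed under complex scalars, so this real complement is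
    also the complex one, and \<open>R\<close> maps it to a complex subspace.\<close>
  define N where "N = {m. \<forall>k\<in>K. inner m k = 0}"
  have "subspace N"
    by (auto simp: N_def subspace_def inner_add_left)
  then have subV: "subspace (closure (R ` N))"
    using blR by (intro subspace_closure linear_subspace_image)
      (simp_all add: bounded_clinear_def bounded_linear.linear)
  have scC: "c *\<^sub>C v \<in> closure (R ` N)" if "v \<in> closure (R ` N)" for c v
  proof -
    have "(*\<^sub>C) c ` closure (R ` N) \<subseteq> closure ((*\<^sub>C) c ` R ` N)"
      by (rule closure_bounded_linear_image_subset [OF bounded_linear_scaleC])
    also have "\<dots> \<subseteq> closure (R ` N)"
    proof (rule closure_mono)
      show "(*\<^sub>C) c ` R ` N \<subseteq> R ` N"
      proof clarify
        fix m
        assume "m \<in> N"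
        then have "c *\<^sub>C m \<in> N"
          using K(3) by (simp add: N_def inner_scaleC_left)
        moreover have "c *\<^sub>C R m = R (c *\<^sub>C m)"
          using blR by (simp add: bounded_clinear_def)
        ultimately show "c *\<^sub>C R m \<in> R ` N"
          by simp
      qed
    qed
    finally show ?thesis
      using that by blast
  qed
  obtain Q where saQ: "selfadjoint Q" and QV: "\<And>x. Q x \<in> closure (R ` N)"
    and Q: "\<And>x v. v \<in> closure (R ` N) \<Longrightarrow> inner (x - Q x) v = 0"
    using orthogonal_projection [OF subV closed_closure scC] by (metis rangeI subsetD)
  define Z where "Z x = R (R x - Q (R x))" for x
  have saZ: "selfadjoint Z"
    using selfadjoint_conj [OF selfadjoint_minus [OF selfadjoint_ident saQ] saR]
    by (simp add: Z_def [abs_def])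
  have formZ: "inner (Z x) x = (norm (R x - Q (R x)))\<^sup>2" for x
  proof -
    have "inner (Z x) x = inner (R x - Q (R x)) (R x)"
      by (simp add: Z_def selfadjoint_inner [OF saR])
    then show ?thesis
      using Q [OF QV, of "R x" "R x"] by (simp add: power2_norm_eq_inner inner_diff_right)
  qed
  have ZK: "Z x \<in> K" for x
  proof -
    \<comment> \<open>With \<open>p\<close> the projection of \<open>Z x\<close> to
      \<open>K\<close>, \<open>Z x - p\<close> is in \<open>N\<close>. Its image under
      \<open>R\<close> is then orthogonal to \<open>R x - Q (R x)\<close>, which forces
      \<open>Z x = p\<close>.\<close>
    obtain p where p: "p \<in> K" "\<And>v. v \<in> K \<Longrightarrow> inner (Z x - p) v = 0"
      using projection_exists [OF K(1,2)] by blast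
    then have "R (Z x - p) \<in> closure (R ` N)"
      by (intro subsetD [OF closure_subset]) (auto simp: N_def)
    then have "inner (Z x) (Z x - p) = 0"
      using Q by (simp add: Z_def selfadjoint_inner [OF saR])
    moreover have "inner p (Z x - p) = 0"
      using p by (simp add: inner_commute)
    ultimately have "inner (Z x - p) (Z x - p) = 0"
      by (simp add: inner_diff_left)
    then show ?thesis
      using p(1) by simp
  qed
  have formZ_le: "inner (Z x) x \<le> inner (S x) x" for x
  proof -
    have "(norm (R x - Q (R x)))\<^sup>2 = (norm (R x))\<^sup>2 - (norm (Q (R x)))\<^sup>2"
      using Q [OF QV, of "R x" "R x"]
      by (simp add: power2_norm_eq_inner inner_diff_left inner_diff_right inner_commute)
    moreover have "inner (S x) x = (norm (R x))\<^sup>2"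
      by (simp add: power2_norm_eq_inner selfadjoint_inner [OF saR] flip: RR)
    ultimately show ?thesis
      by (simp add: formZ)
  qed
  have cand: "Z \<in> short_candidates S K"
    using saZ formZ formZ_le ZK assms(1)
    by (auto simp: short_candidates_def nonneg_op_iff op_le_iff)
  have greatest: "op_le W Z" if "W \<in> short_candidates S K" for W
  proof -
    have W: "selfadjoint W" "\<And>x. inner (W x) x \<le> inner (S x) x" "\<And>x. W x \<in> K"
      using that by (auto simp: short_candidates_def op_le_iff)
    note blW = selfadjoint_bounded_clinear [OF W(1)]
    have "inner (W x) x \<le> inner (Z x) x" for x
    proof -
      \<comment> \<open>A symmetric \<open>W\<close> with range in \<open>K\<close> vanishes on
        \<open>N\<close>, so its form is constant on \<open>x + N\<close>, while the form of
        \<open>S\<close> at \<open>x - m\<close> is the squared distance from \<open>R x\<close> to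
        \<open>R m\<close>. The set is closed, so the bound reaches \<open>Q (R x)\<close>.\<close>
      have "R ` N \<subseteq> {v. inner (W x) x \<le> (norm (R x - v))\<^sup>2}"
      proof clarify
        fix m
        assume "m \<in> N"
        then have "inner m (W y) = 0" for y
          using W(3) by (simp add: N_def)
        then have Wm: "inner y (W m) = 0" for y
          by (metis inner_commute selfadjoint_inner [OF W(1)])
        have "W m = 0"
          using Wm [of "W m"] by simp
        moreover have "inner (W x) m = 0"
          using Wm [of x] by (simp only: selfadjoint_inner [OF W(1)])
        ultimately have "inner (W (x - m)) (x - m) = inner (W x) x"
          by (simp add: bounded_clinear_diff [OF blW] inner_diff_right)
        then have "inner (W x) x \<le> inner (S (x - m)) (x - m)"
          using W(2) [of "x - m"] by simp
        also have "\<dots> = (norm (R (x - m)))\<^sup>2"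
          by (simp only: power2_norm_eq_inner selfadjoint_inner [OF saR] RR [symmetric])
        finally show "inner (W x) x \<le> (norm (R x - R m))\<^sup>2"
          by (simp add: bounded_clinear_diff [OF blR])
      qed
      then have "closure (R ` N) \<subseteq> {v. inner (W x) x \<le> (norm (R x - v))\<^sup>2}"
        by (intro closure_minimal closed_Collect_le continuous_intros)
      then show ?thesis
        using QV [of "R x"] unfolding formZ by blast
    qed
    then show ?thesis
      by (simp add: op_le_iff W saZ)
  qed
  have "\<exists>!Z. Z \<in> short_candidates S K \<and> (\<forall>W \<in> short_candidates S K. op_le W Z)"
    using cand greatest op_le_antisym by blast
  then show ?thesis
    unfolding shorted_def by (rule theI')
qed

section \<open>Passive systems\<close>

lemma contraction_form_le:
  assumes "contraction T"
  shows "inner (T x) (T x) \<le> inner x x"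
  using assms power_mono [of "norm (T x)" "norm x" 2]
  by (simp add: contraction_def flip: power2_norm_eq_inner)

text \<open>Since \<open>0 <= I - T* T <= I\<close>, a square root exists, and whichever one
  \<open>op_sqrt\<close> picks has the prescribed square.\<close>

lemma defect_defect:
  fixes T :: "'a::complex_hilbert \<Rightarrow> 'b::complex_hilbert"
  assumes "contraction T"
  shows "defect T (defect T x) = x - adj T (T x)"
proof -
  have bl: "bounded_clinear T"
    using assms by (simp add: contraction_def)
  define S where "S x = x - adj T (T x)" for x
  have form: "inner (S x) y = inner x y - inner (T x) (T y)" for x y
    by (simp add: S_def inner_diff_left inner_commute [of "adj T (T x)"] inner_commute [of "T x"]
        flip: inner_adj [OF bl])
  have "selfadjoint S"
    unfolding selfadjoint_iff
  proof (intro conjI allI)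
    show "bounded_clinear S"
      unfolding S_def [abs_def]
      by (intro bounded_clinear_minus bounded_clinear_ident
          bounded_clinear_compose [OF bounded_clinear_adj [OF bl] bl])
    show "inner (S x) y = inner x (S y)" for x y
      using form [of x y] form [of y x] by (simp add: inner_commute)
  qed
  then have "nonneg_op S" "op_le S (\<lambda>x. x)"
    using contraction_form_le [OF assms]
    by (simp_all add: nonneg_op_iff op_le_iff selfadjoint_ident form)
  from someI_ex [OF op_sqrt_exists [OF this]]
  have "op_sqrt S \<circ> op_sqrt S = S"
    unfolding op_sqrt_def by blast
  then show ?thesis
    by (simp add: defect_def S_def [abs_def] fun_eq_iff)
qed

section \<open>Operators on the first summand, extended by zero: order passes both ways\<close>

lemma selfadjoint_comp_proj:
  assumes "selfadjoint Y"
  shows "selfadjoint (comp_proj Y :: 'h::complex_hilbert \<times> 'k::complex_hilbert \<Rightarrow> 'h \<times> 'k)"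
proof -
  let ?Z = "comp_proj Y :: 'h \<times> 'k \<Rightarrow> 'h \<times> 'k"
  have "bounded_linear ?Z"
    unfolding comp_proj_def [abs_def] using assms
    by (intro bounded_linear_Pair bounded_linear_zero bounded_linear_compose [OF _ bounded_linear_fst])
      (simp add: selfadjoint_def bounded_clinear_def)
  moreover have "?Z (c *\<^sub>C x) = c *\<^sub>C ?Z x" for c x
    using assms linear_0 [OF bounded_linear.linear [OF bounded_linear_scaleC]]
    by (simp add: comp_proj_def scaleC_prod_def selfadjoint_def bounded_clinear_def)
  moreover have "inner (?Z x) y = inner x (?Z y)" for x y
    using assms by (simp add: comp_proj_def inner_prod_def selfadjoint_inner)
  ultimately show ?thesis
    unfolding selfadjoint_iff bounded_clinear_def by blast
qed

lemma op_le_comp_proj: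
  assumes "op_le Y Y'"
  shows "op_le (comp_proj Y) (comp_proj Y')"
  using assms by (simp add: op_le_iff selfadjoint_comp_proj comp_proj_def inner_prod_def)

lemma nonneg_op_comp_proj: "nonneg_op Y \<Longrightarrow> nonneg_op (comp_proj Y)"
  by (simp add: nonneg_op_iff selfadjoint_comp_proj comp_proj_def inner_prod_def)

lemma selfadjoint_comp_projD:
  fixes Y :: "'h::complex_hilbert \<Rightarrow> 'h"
  assumes "selfadjoint (comp_proj Y :: 'h \<times> 'k::complex_hilbert \<Rightarrow> 'h \<times> 'k)"
  shows "selfadjoint Y"
proof -
  let ?Z = "comp_proj Y :: 'h \<times> 'k \<Rightarrow> 'h \<times> 'k"
  have bl: "bounded_linear ?Z" and scC: "\<And>c x. ?Z (c *\<^sub>C x) = c *\<^sub>C ?Z x"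
    using assms by (auto simp: selfadjoint_def bounded_clinear_def)
  have "bounded_linear (\<lambda>h. fst (?Z (h, 0)))"
    by (intro bounded_linear_fst_comp bounded_linear_compose [OF bl] bounded_linear_Pair
        bounded_linear_ident bounded_linear_zero)
  moreover have "Y (c *\<^sub>C h) = c *\<^sub>C Y h" for c h
    using arg_cong [OF scC [of c "(h, 0)"], of fst] by (simp add: comp_proj_def scaleC_prod_def)
  moreover have "inner (Y x) y = inner x (Y y)" for x y
    using selfadjoint_inner [OF assms, of "(x, 0)" "(y, 0)"]
    by (simp add: comp_proj_def inner_prod_def)
  ultimately show ?thesis
    by (simp add: selfadjoint_iff bounded_clinear_def comp_proj_def)
qed

lemma op_le_comp_projD:
  fixes Y Y' :: "'h::complex_hilbert \<Rightarrow> 'h"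
  assumes "op_le (comp_proj Y :: 'h \<times> 'k::complex_hilbert \<Rightarrow> 'h \<times> 'k) (comp_proj Y')"
  shows "op_le Y Y'"
proof -
  have "inner (Y x) x \<le> inner (Y' x) x" for x
    using assms by (auto simp: op_le_iff comp_proj_def inner_prod_def dest!: spec [of _ "(x, 0)"])
  then show ?thesis
    using assms by (auto simp: op_le_iff dest: selfadjoint_comp_projD)
qed

lemma nonneg_op_comp_projD:
  fixes Y :: "'h::complex_hilbert \<Rightarrow> 'h"
  assumes "nonneg_op (comp_proj Y :: 'h \<times> 'k::complex_hilbert \<Rightarrow> 'h \<times> 'k)"
  shows "nonneg_op Y"
proof -
  have "0 \<le> inner (Y x) x" for x
    using assms by (auto simp: nonneg_op_iff comp_proj_def inner_prod_def dest!: spec [of _ "(x, 0)"])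
  then show ?thesis
    using assms by (auto simp: nonneg_op_iff dest: selfadjoint_comp_projD)
qed

section \<open>The operator to be shorted and its quadratic form\<close>

definition system_op ::
    "('h::complex_hilbert \<times> 'm::complex_hilbert \<Rightarrow> 'h \<times> 'n::complex_hilbert) \<Rightarrow>
      ('h \<Rightarrow> 'h) \<Rightarrow> 'h \<times> 'm \<Rightarrow> 'h \<times> 'm" where
  "system_op T Y = (\<lambda>x. defect T (defect T x) + adj T (comp_proj Y (T x)))"

lemma short_op_eq: "short_op T Y = shorted (system_op T Y) fst_summand"
  by (simp add: short_op_def system_op_def)

lemma inner_system_op:
  assumes "contraction T"
  shows "inner (system_op T Y x) y =
    inner x y - inner (T x) (T y) + inner (Y (fst (T x))) (fst (T y))"
proof -
  have bl: "bounded_clinear T"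
    using assms by (simp add: contraction_def)
  show ?thesis
    by (simp add: system_op_def defect_defect [OF assms] inner_add_left inner_diff_left
        comp_proj_def inner_prod_def [of _ "(_, _)"] inner_commute [of "adj T _"]
        inner_commute [of _ "T x"] inner_commute [of _ "Y _"] flip: inner_adj [OF bl])
qed

lemma selfadjoint_system_op:
  assumes "contraction T" and "selfadjoint Y"
  shows "selfadjoint (system_op T Y)"
  unfolding selfadjoint_iff
proof (intro conjI allI)
  have bl: "bounded_clinear T"
    using assms by (simp add: contraction_def)
  note blA = bounded_clinear_adj [OF bl]
  show "bounded_clinear (system_op T Y)"
    unfolding system_op_def defect_defect [OF assms(1)]
    by (intro bounded_clinear_plus bounded_clinear_minus bounded_clinear_ident
        bounded_clinear_compose [OF blA bl]
        bounded_clinear_compose [OF blA bounded_clinear_compose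
          [OF selfadjoint_bounded_clinear [OF selfadjoint_comp_proj [OF assms(2)]] bl]])
  show "inner (system_op T Y x) y = inner x (system_op T Y y)" for x y
    using inner_system_op [OF assms(1), of Y x y] inner_system_op [OF assms(1), of Y y x]
      selfadjoint_inner [OF assms(2), of "fst (T x)" "fst (T y)"]
    by (simp add: inner_commute)
qed

lemma system_op_mono:
  assumes "contraction T" and "op_le Y Y'"
  shows "op_le (system_op T Y) (system_op T Y')"
  using assms by (simp add: op_le_iff selfadjoint_system_op inner_system_op)

lemma system_op_nonneg_op:
  assumes "contraction T" and "nonneg_op Y"
  shows "nonneg_op (system_op T Y)"
  using assms contraction_form_le [OF assms(1)]
  by (simp add: nonneg_op_iff selfadjoint_system_op inner_system_op)

lemma system_op_le_ident:
  assumes "contraction T" and "op_le Y (\<lambda>h. h)"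
  shows "op_le (system_op T Y) (\<lambda>x. x)"
  unfolding op_le_iff
proof (intro conjI allI)
  show "inner (system_op T Y x) x \<le> inner x x" for x
  proof -
    have "inner (Y (fst (T x))) (fst (T x)) \<le> inner (fst (T x)) (fst (T x))"
      using assms(2) by (simp add: op_le_iff)
    also have "\<dots> \<le> inner (T x) (T x)"
      by (simp add: inner_prod_def)
    finally show ?thesis
      by (simp add: inner_system_op [OF assms(1)])
  qed
qed (use assms in \<open>simp_all add: op_le_iff selfadjoint_system_op selfadjoint_ident\<close>)

section \<open>Shorting and the recursion for a fixed contraction\<close>

context
  fixes T :: "'h::complex_hilbert \<times> 'm::complex_hilbert \<Rightarrow> 'h \<times> 'n::complex_hilbert"
  assumes contr: "contraction T"
begin

lemma short_op_greatest:
  assumes "nonneg_op Y" and "op_le Y (\<lambda>h. h)"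
  shows "short_op T Y \<in> short_candidates (system_op T Y) fst_summand"
    and "Z \<in> short_candidates (system_op T Y) fst_summand \<Longrightarrow> op_le Z (short_op T Y)"
proof -
  have "subspace (fst_summand :: ('h \<times> 'm) set)"
    by (auto simp: fst_summand_def subspace_def zero_prod_def)
  moreover have "closed (fst_summand :: ('h \<times> 'm) set)"
    by (simp add: fst_summand_def closed_Times)
  moreover have "c *\<^sub>C v \<in> fst_summand" if "v \<in> fst_summand" for c and v :: "'h \<times> 'm"
    using that linear_0 [OF bounded_linear.linear [OF bounded_linear_scaleC]]
    by (auto simp: fst_summand_def scaleC_prod_def)
  ultimately have *: "short_op T Y \<in> short_candidates (system_op T Y) fst_summand \<and>
      (\<forall>Z \<in> short_candidates (system_op T Y) fst_summand. op_le Z (short_op T Y))"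
    unfolding short_op_eq using assms contr
    by (intro shorted_greatest system_op_nonneg_op system_op_le_ident)
  show "short_op T Y \<in> short_candidates (system_op T Y) fst_summand"
    using * by blast
  show "op_le Z (short_op T Y)" if "Z \<in> short_candidates (system_op T Y) fst_summand"
    using * that by blast
qed

text \<open>Maximality in the form used: \<open>comp_proj Z\<close> already has range in the first
  summand, so a bound by the unshorted operator is enough.\<close>

lemma comp_proj_le_short_op:
  assumes "nonneg_op Y" and "op_le Y (\<lambda>h. h)"
    and "nonneg_op Z" and "op_le (comp_proj Z) (system_op T Y)"
  shows "op_le (comp_proj Z) (short_op T Y)"
proof (rule short_op_greatest(2) [OF assms(1,2)])
  show "comp_proj Z \<in> short_candidates (system_op T Y) fst_summand"
    using assms(3,4)
    by (auto simp: short_candidates_def fst_summand_def comp_proj_def [of Z] nonneg_op_comp_proj)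
qed

text \<open>The short for \<open>Y\<close> is itself a candidate in the maximum that defines the
  short for \<open>Y'\<close>.\<close>

lemma short_op_mono:
  assumes "nonneg_op Y" and "op_le Y Y'" and "op_le Y' (\<lambda>h. h)"
  shows "op_le (short_op T Y) (short_op T Y')"
proof -
  have Y: "op_le Y (\<lambda>h. h)"
    using assms(2,3) by (rule op_le_trans)
  have "nonneg_op Y'"
    using assms(1,2) op_le_trans unfolding nonneg_op_def by blast
  moreover have "short_op T Y \<in> short_candidates (system_op T Y') fst_summand"
    using short_op_greatest(1) [OF assms(1) Y] op_le_trans [OF _ system_op_mono [OF contr assms(2)]]
    by (auto simp: short_candidates_def)
  ultimately show ?thesis
    using assms(3) short_op_greatest(2) by blast
qed

text \<open>One step of the recursion \<open>Yseq\<close>, as a map on operators of the first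
  summand.\<close>

definition reduced :: "('h \<Rightarrow> 'h) \<Rightarrow> 'h \<Rightarrow> 'h" where
  "reduced Y h = fst (short_op T Y (h, 0))"

text \<open>A selfadjoint operator with range in the first summand annihilates the second one, so
  its values at \<open>(h, 0)\<close> determine it.\<close>

lemma comp_proj_reduced:
  assumes "nonneg_op Y" and "op_le Y (\<lambda>h. h)"
  shows "comp_proj (reduced Y) = short_op T Y"
proof
  fix x :: "'h \<times> 'm"
  have sa: "selfadjoint (short_op T Y)" and ran: "range (short_op T Y) \<subseteq> fst_summand"
    using short_op_greatest(1) [OF assms] by (simp_all add: short_candidates_def nonneg_op_iff)
  have snd: "snd (short_op T Y x) = 0" for x
    using subsetD [OF ran rangeI, of x] by (simp add: fst_summand_def mem_Times_iff)
  have "inner (short_op T Y (0, snd x)) (short_op T Y (0, snd x)) = 0"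
    unfolding selfadjoint_inner [OF sa, of "(0, snd x)"] by (simp add: inner_prod_def snd)
  then have "short_op T Y (0, snd x) = 0"
    by simp
  then have "short_op T Y x = short_op T Y (fst x, 0)"
    using bounded_clinear_add [OF selfadjoint_bounded_clinear [OF sa], of "(fst x, 0)" "(0, snd x)"]
    by simp
  then show "comp_proj (reduced Y) x = short_op T Y x"
    by (simp add: comp_proj_def reduced_def prod_eq_iff snd)
qed

lemma nonneg_op_reduced:
  assumes "nonneg_op Y" and "op_le Y (\<lambda>h. h)"
  shows "nonneg_op (reduced Y)"
proof (rule nonneg_op_comp_projD)
  show "nonneg_op (comp_proj (reduced Y) :: 'h \<times> 'm \<Rightarrow> _)"
    unfolding comp_proj_reduced [OF assms]
    using short_op_greatest(1) [OF assms] by (simp add: short_candidates_def)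
qed

lemma reduced_form_le:
  assumes "nonneg_op Y" and "op_le Y (\<lambda>h. h)"
  shows "inner (reduced Y h) h \<le> inner (system_op T Y (h, 0)) (h, 0)"
proof -
  have "op_le (comp_proj (reduced Y) :: 'h \<times> 'm \<Rightarrow> _) (system_op T Y)"
    unfolding comp_proj_reduced [OF assms]
    using short_op_greatest(1) [OF assms] by (simp add: short_candidates_def)
  then have "inner (comp_proj (reduced Y) (h, 0 :: 'm)) (h, 0) \<le> inner (system_op T Y (h, 0)) (h, 0)"
    by (rule op_leD)
  then show ?thesis
    by (simp add: comp_proj_def inner_prod_def)
qed

lemma reduced_le_ident:
  assumes "nonneg_op Y" and "op_le Y (\<lambda>h. h)"
  shows "op_le (reduced Y) (\<lambda>h. h)"
proof -
  have "inner (reduced Y h) h \<le> inner h h" for h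
  proof -
    have "inner (system_op T Y (h, 0)) (h, 0) \<le> inner (h, 0 :: 'm) (h, 0)"
      using system_op_le_ident [OF contr assms(2)] by (rule op_leD)
    then show ?thesis
      using reduced_form_le [OF assms, of h] by (simp add: inner_prod_def)
  qed
  then show ?thesis
    using nonneg_op_reduced [OF assms] by (simp add: op_le_iff nonneg_op_iff selfadjoint_ident)
qed

lemma reduced_mono:
  assumes "nonneg_op Y" and "op_le Y Y'" and "op_le Y' (\<lambda>h. h)"
  shows "op_le (reduced Y) (reduced Y')"
proof -
  have "op_le Y (\<lambda>h. h)" and "nonneg_op Y'"
    using assms op_le_trans unfolding nonneg_op_def by blast+
  then have "op_le (comp_proj (reduced Y) :: 'h \<times> 'm \<Rightarrow> _) (comp_proj (reduced Y'))"
    using assms by (simp add: comp_proj_reduced short_op_mono)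
  then show ?thesis
    by (rule op_le_comp_projD)
qed

lemma Yseq_Suc: "Yseq T (Suc n) = reduced (Yseq T n)"
  by (simp add: reduced_def [abs_def])

lemma Yseq_bounds: "nonneg_op (Yseq T n) \<and> op_le (Yseq T n) (\<lambda>h. h)"
proof (induction n)
  case 0
  show ?case
    by (simp add: nonneg_op_iff op_le_iff selfadjoint_ident)
next
  case (Suc n)
  then show ?case
    by (simp only: Yseq_Suc nonneg_op_reduced reduced_le_ident)
qed

lemmas Yseq_nonneg = Yseq_bounds [THEN conjunct1]
lemmas Yseq_le_ident = Yseq_bounds [THEN conjunct2]

lemma Yseq_step: "op_le (Yseq T (Suc n)) (Yseq T n)"
proof (induction n)
  case 0
  show ?case
    using Yseq_le_ident [of 1] by simp
next
  case (Suc n)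
  then show ?case
    unfolding Yseq_Suc [of "Suc n"] Yseq_Suc [of n]
    by (metis Yseq_Suc reduced_mono Yseq_nonneg Yseq_le_ident)
qed

lemma Yseq_decreasing:
  assumes "m \<le> n"
  shows "op_le (Yseq T n) (Yseq T m)"
  using assms
proof (induction rule: dec_induct)
  case base
  show ?case
    using Yseq_nonneg [of m] by (simp add: op_le_iff nonneg_op_iff)
next
  case (step n)
  then show ?case
    using Yseq_step op_le_trans by blast
qed

text \<open>Inductively, \<open>Y P\<close> is below the short for \<open>Y\<close>, which by
  monotonicity is below the short for the n-th iterate, that is, the next iterate.\<close>

lemma solution_le_Yseq:
  assumes "nonneg_op Y" and "op_le Y (\<lambda>h. h)" and "op_le (comp_proj Y) (short_op T Y)"
  shows "op_le Y (Yseq T n)"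
proof (induction n)
  case 0
  show ?case
    using assms(2) by simp
next
  case (Suc n)
  have "op_le (comp_proj Y :: 'h \<times> 'm \<Rightarrow> _) (comp_proj (Yseq T (Suc n)))"
    unfolding Yseq_Suc comp_proj_reduced [OF Yseq_nonneg Yseq_le_ident]
    using assms(3) short_op_mono [OF assms(1) Suc Yseq_le_ident] by (rule op_le_trans)
  then show ?case
    by (rule op_le_comp_projD)
qed

text \<open>For the lower bound on the short, \<open>Y P\<close> is below every unshorted operator
  of an iterate, hence below their limit in the sense of forms, and maximality applies. The upper
  bound is monotonicity of \<open>reduced\<close> followed by the limit.\<close>

lemma Yseq_limit_fixed_point:
  assumes lim: "strong_limit (Yseq T) Y" and "nonneg_op Y" and le: "\<And>n. op_le Y (Yseq T n)"
  shows "comp_proj Y = short_op T Y"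
proof (rule op_le_antisym)
  have Y_le: "op_le Y (\<lambda>h. h)"
    using le [of 0] by simp
  have conv: "(\<lambda>n. Yseq T n h) \<longlonglongrightarrow> Y h" for h
    using lim by (simp add: strong_limit_def)
  show "op_le (comp_proj Y) (short_op T Y)"
  proof (rule comp_proj_le_short_op [OF assms(2) Y_le assms(2)])
    have "inner (comp_proj Y x) x \<le> inner (system_op T Y x) x" for x
    proof (rule LIMSEQ_le_const)
      show "(\<lambda>n. inner (system_op T (Yseq T n) x) x) \<longlonglongrightarrow> inner (system_op T Y x) x"
        unfolding inner_system_op [OF contr] by (intro tendsto_intros conv)
      have "inner (comp_proj Y x) x \<le> inner (system_op T (Yseq T n) x) x" for n
      proof -
        have "op_le (comp_proj Y :: 'h \<times> 'm \<Rightarrow> _) (comp_proj (Yseq T (Suc n)))"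
          by (rule op_le_comp_proj [OF le])
        moreover have "op_le (comp_proj (Yseq T (Suc n))) (system_op T (Yseq T n))"
          unfolding Yseq_Suc comp_proj_reduced [OF Yseq_nonneg Yseq_le_ident]
          using short_op_greatest(1) [OF Yseq_nonneg Yseq_le_ident]
          by (simp add: short_candidates_def)
        ultimately show ?thesis
          by (intro op_leD) (rule op_le_trans)
      qed
      then show "\<exists>N. \<forall>n\<ge>N. inner (comp_proj Y x) x \<le> inner (system_op T (Yseq T n) x) x"
        by blast
    qed
    then show "op_le (comp_proj Y) (system_op T Y)"
      using assms(2)
      by (simp add: op_le_iff selfadjoint_comp_proj selfadjoint_system_op contr nonneg_op_iff)
  qed
  have "op_le (reduced Y) Y"
    unfolding op_le_iff
  proof (intro conjI allI)
    show "inner (reduced Y h) h \<le> inner (Y h) h" for h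
    proof (rule LIMSEQ_le_const)
      \<comment> \<open>The shift is essential: \<open>Y\<close> below the n-th iterate puts
        \<open>reduced Y\<close> below the next one.\<close>
      show "(\<lambda>n. inner (Yseq T (Suc n) h) h) \<longlonglongrightarrow> inner (Y h) h"
        by (intro tendsto_intros LIMSEQ_Suc conv)
      show "\<exists>N. \<forall>n\<ge>N. inner (reduced Y h) h \<le> inner (Yseq T (Suc n) h) h"
        using reduced_mono [OF assms(2) le Yseq_le_ident] unfolding Yseq_Suc op_le_iff by blast
    qed
  qed (use assms(2) nonneg_op_reduced [OF assms(2) Y_le] in \<open>simp_all add: nonneg_op_iff\<close>)
  then show "op_le (short_op T Y) (comp_proj Y)"
    unfolding comp_proj_reduced [OF assms(2) Y_le, symmetric] by (rule op_le_comp_proj)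
qed

end

text \<open>Testing the inequality at \<open>(h, 0)\<close> gives \<open>(Y h, h) \<le> \<parallel>h\<parallel>\<^sup>2 - \<parallel>C h\<parallel>\<^sup>2 - ((I - Y) A h, A h)\<close>,
  so \<open>Y h = h\<close> forces \<open>C h = 0\<close> and \<open>Y A h = A h\<close>.\<close>

lemma observable_kernel_trivial:
  fixes A :: "'h::complex_hilbert \<Rightarrow> 'h" and B :: "'m::complex_hilbert \<Rightarrow> 'h"
    and C :: "'h \<Rightarrow> 'n::complex_hilbert" and D :: "'m \<Rightarrow> 'n"
  assumes contr: "contraction (block_op A B C D)"
    and "bounded_clinear A" "bounded_clinear B" "bounded_clinear C" "bounded_clinear D"
    and obs: "observable A C"
    and Y: "nonneg_op Y" "op_le Y (\<lambda>h. h)"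
    and le: "op_le (comp_proj Y) (short_op (block_op A B C D) Y)"
  shows "op_kernel (\<lambda>h. h - Y h) = {0}"
proof -
  let ?T = "block_op A B C D"
  note zero = assms(2-5) [THEN bounded_clinear_zero]
  have step: "C h = 0 \<and> Y (A h) = A h" if "Y h = h" for h
  proof -
    have T: "?T (h, 0) = (A h, C h)"
      by (simp add: block_op_def zero)
    have "op_le (comp_proj Y) (system_op ?T Y)"
      using le short_op_greatest(1) [OF contr Y] op_le_trans by (auto simp: short_candidates_def)
    then have "inner (comp_proj Y (h, 0 :: 'm)) (h, 0) \<le> inner (system_op ?T Y (h, 0)) (h, 0)"
      by (rule op_leD)
    then have le0: "inner (A h - Y (A h)) (A h) + inner (C h) (C h) \<le> 0"
      unfolding inner_system_op [OF contr] T
      by (simp add: comp_proj_def inner_prod_def that inner_diff_left)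
    have pos: "nonneg_op (\<lambda>h. h - Y h)"
      by (rule nonneg_op_minus [OF Y(2)])
    then have "0 \<le> inner (A h - Y (A h)) (A h)"
      by (simp add: nonneg_op_iff)
    with le0 have "inner (C h) (C h) = 0" "inner (A h - Y (A h)) (A h) = 0"
      using inner_ge_zero [of "C h"] by linarith+
    then show ?thesis
      using nonneg_op_form_zero [OF pos, of "A h"] by simp
  qed
  have "h = 0" if "Y h = h" for h
  proof -
    \<comment> \<open>The whole orbit of \<open>h\<close> under \<open>A\<close> is fixed by
      \<open>Y\<close>, so \<open>C\<close> annihilates it and observability gives
      \<open>h = 0\<close>.\<close>
    have "Y ((A ^^ n) h) = (A ^^ n) h" for n
      using that step by (induction n) simp_all
    then have "h \<in> (\<Inter>n. op_kernel (C \<circ> (A ^^ n)))"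
      using step by (simp add: op_kernel_def)
    then show ?thesis
      using obs unfolding observable_def by blast
  qed
  moreover have "Y 0 = 0"
    using Y(1) by (simp add: nonneg_op_iff selfadjoint_def bounded_clinear_zero)
  ultimately show ?thesis
    by (auto simp: op_kernel_def)
qed

theorem theorem8p1:
  fixes A :: "'h::complex_hilbert \<Rightarrow> 'h"
    and B :: "'m::complex_hilbert \<Rightarrow> 'h"
    and C :: "'h \<Rightarrow> 'n::complex_hilbert"
    and D :: "'m \<Rightarrow> 'n"
    and T :: "'h \<times> 'm \<Rightarrow> 'h \<times> 'n"
  assumes T_def: "T = block_op A B C D"
    and passive_T: "passive_system A B C D"
    and obs: "observable A C"
  shows "(\<forall>n. nonneg_op (Yseq T n) \<and> contraction (Yseq T n)) \<and>
    (\<forall>m n. m \<le> n \<longrightarrow> op_le (Yseq T n) (Yseq T m)) \<and>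
    (\<exists>Y0. strong_limit (Yseq T) Y0 \<and>
      comp_proj Y0 = short_op T Y0 \<and>
      op_kernel (\<lambda>h. h - Y0 h) = {0} \<and>
      solution T Y0 \<and>
      (\<forall>Y. solution T Y \<longrightarrow> op_le Y Y0))"
proof -
  have contr: "contraction T" and bl: "bounded_clinear A" "bounded_clinear B" "bounded_clinear C"
    "bounded_clinear D"
    using passive_T by (simp_all add: passive_system_def T_def)
  note nonneg = Yseq_nonneg [OF contr] and le_ident = Yseq_le_ident [OF contr]
    and decr = Yseq_decreasing [OF contr]
  have Yseq_contr: "contraction (Yseq T n)" for n
    using nonneg_op_le_ident_norm [OF nonneg le_ident] nonneg [of n]
    by (simp add: contraction_def nonneg_op_iff selfadjoint_bounded_clinear)
  obtain Y0 where Y0: "strong_limit (Yseq T) Y0" "nonneg_op Y0" "\<And>n. op_le Y0 (Yseq T n)"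
    using op_decreasing_limit [of "Yseq T", OF nonneg le_ident decr] by blast
  have Y0_le: "op_le Y0 (\<lambda>h. h)"
    using Y0(3) [of 0] by simp
  have fixed: "comp_proj Y0 = short_op T Y0"
    by (rule Yseq_limit_fixed_point [OF contr Y0])
  have le: "op_le (comp_proj Y0) (short_op T Y0)"
    using op_le_comp_proj [of Y0 Y0] Y0(2) unfolding fixed [symmetric]
    by (simp add: op_le_iff nonneg_op_iff)
  have ker: "op_kernel (\<lambda>h. h - Y0 h) = {0}"
    using contr le unfolding T_def
    by (intro observable_kernel_trivial [OF _ bl obs Y0(2) Y0_le])
  have "solution T Y0"
    by (simp add: solution_def Y0 Y0_le ker le)
  moreover have "op_le Y Y0" if "solution T Y" for Y
  proof -
    have Y: "nonneg_op Y" "op_le Y (\<lambda>h. h)" "op_le (comp_proj Y) (short_op T Y)"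
      using that by (auto simp: solution_def)
    \<comment> \<open>A solution lies below every iterate, and this survives the limit of the
      forms.\<close>
    have "inner (Y h) h \<le> inner (Y0 h) h" for h
    proof (rule LIMSEQ_le_const)
      show "(\<lambda>n. inner (Yseq T n h) h) \<longlonglongrightarrow> inner (Y0 h) h"
        using Y0(1) by (intro tendsto_intros) (simp add: strong_limit_def)
      show "\<exists>N. \<forall>n\<ge>N. inner (Y h) h \<le> inner (Yseq T n h) h"
        using solution_le_Yseq [OF contr Y] by (auto simp: op_le_iff)
    qed
    then show ?thesis
      using Y(1) Y0(2) by (simp add: op_le_iff nonneg_op_iff)
  qed
  ultimately show ?thesis
    using nonneg Yseq_contr decr Y0(1) fixed ker by blast
qed

end
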